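(* Let $0<H<1$, $0<K\leq 1$ and $T>0$. Let $\{W_t^{H,K}, 0\leq t\leq T\}$ be a bifractional Brownian motion with parameters $H,K$, let $\{W^{HK}(t), 0\leq t\leq T\}$ be a fractional Brownian motion with Hurst index $HK$, and put $Y^{(1)}_t=2^{(1-K)/2}W^{HK}(t)$ and $Y^{(2)}_t=2^{-K/2}W^{HK}(t)$. Then $$E\Big[\sup_{0\leq t\leq T}W_t^{H,K}\Big]\leq E\Big[\sup_{0\leq t\leq T}Y^{(1)}_t\Big]$$ and $$E\Big[\sup_{0\leq t\leq T}W_t^{H,K}\Big]\geq E\Big[\sup_{0\leq t\leq T}Y^{(2)}_t\Big].$$
   Context: A bifractional Brownian motion with parameters $H\in(0,1)$, $K\in(0,1]$ is a centered Gaussian process $\{W_t^{H,K},t\geq 0\}$ with covariance function $$C_H(s,t)=\frac{1}{2^K}\big[(t^{2H}+s^{2H})^K-|s-t|^{2HK}\big].$$ A fractional Brownian motion with Hurst index $h\in(0,1)$ is a centered Gaussian process with covariance function $\frac12(t^{2h}+s^{2h}-|t-s|^{2h})$; here $h=HK$. All processes are assumed to have almost surely continuous sample paths on $[0,T]$. *)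

theory Defs
  imports "HOL-Probability.Probability"
begin

(* A constant counts as Gaussian (the case of variance zero): both processes below vanish
   almost surely at time 0. *)
definition gaussian_rv :: "'a measure \<Rightarrow> ('a \<Rightarrow> real) \<Rightarrow> bool" where
  "gaussian_rv M X \<longleftrightarrow> X \<in> borel_measurable M \<and>
     ((\<exists>\<mu>. AE \<omega> in M. X \<omega> = \<mu>) \<or>
      (\<exists>\<mu> \<sigma>. 0 < \<sigma> \<and> distributed M lborel X (normal_density \<mu> \<sigma>)))"

(* Gaussian finite-dimensional distributions, i.e. every finite linear combination of the
   values of the process is Gaussian. *)
definition gaussian_process :: "'a measure \<Rightarrow> 'i set \<Rightarrow> ('i \<Rightarrow> 'a \<Rightarrow> real) \<Rightarrow> bool" where
  "gaussian_process M I X \<longleftrightarrow> prob_space M \<and> (\<forall>t\<in>I. X t \<in> borel_measurable M) \<and>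
     (\<forall>J c. finite J \<and> J \<subseteq> I \<longrightarrow> gaussian_rv M (\<lambda>\<omega>. \<Sum>t\<in>J. c t * X t \<omega>))"

definition covariance :: "'a measure \<Rightarrow> ('a \<Rightarrow> real) \<Rightarrow> ('a \<Rightarrow> real) \<Rightarrow> real" where
  "covariance M X Y =
     (LINT \<omega>|M. (X \<omega> - (LINT \<omega>'|M. X \<omega>')) * (Y \<omega> - (LINT \<omega>'|M. Y \<omega>')))"

definition centered_gaussian_process ::
  "'a measure \<Rightarrow> 'i set \<Rightarrow> ('i \<Rightarrow> 'i \<Rightarrow> real) \<Rightarrow> ('i \<Rightarrow> 'a \<Rightarrow> real) \<Rightarrow> bool" where
  "centered_gaussian_process M I C X \<longleftrightarrow> gaussian_process M I X \<and>
     (\<forall>t\<in>I. (LINT \<omega>|M. X t \<omega>) = 0) \<and>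
     (\<forall>s\<in>I. \<forall>t\<in>I. covariance M (X s) (X t) = C s t)"

(* Here and below 0 powr a = 0 is the intended value, since all exponents of possibly
   vanishing bases are positive. *)
definition bifractional_cov :: "real \<Rightarrow> real \<Rightarrow> real \<Rightarrow> real \<Rightarrow> real" where
  "bifractional_cov H K s t =
     1 / 2 powr K * ((t powr (2 * H) + s powr (2 * H)) powr K - \<bar>s - t\<bar> powr (2 * H * K))"

definition fractional_cov :: "real \<Rightarrow> real \<Rightarrow> real \<Rightarrow> real" where
  "fractional_cov h s t =
     1 / 2 * (t powr (2 * h) + s powr (2 * h) - \<bar>t - s\<bar> powr (2 * h))"

definition bifractional_brownian_motion ::
  "'a measure \<Rightarrow> real set \<Rightarrow> real \<Rightarrow> real \<Rightarrow> (real \<Rightarrow> 'a \<Rightarrow> real) \<Rightarrow> bool" where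
  "bifractional_brownian_motion M I H K W \<longleftrightarrow> 0 < H \<and> H < 1 \<and> 0 < K \<and> K \<le> 1 \<and>
     centered_gaussian_process M I (bifractional_cov H K) W"

definition fractional_brownian_motion ::
  "'a measure \<Rightarrow> real set \<Rightarrow> real \<Rightarrow> (real \<Rightarrow> 'a \<Rightarrow> real) \<Rightarrow> bool" where
  "fractional_brownian_motion M I h B \<longleftrightarrow> 0 < h \<and> h < 1 \<and>
     centered_gaussian_process M I (fractional_cov h) B"

definition continuous_paths_ae ::
  "'a measure \<Rightarrow> real set \<Rightarrow> (real \<Rightarrow> 'a \<Rightarrow> real) \<Rightarrow> bool" where
  "continuous_paths_ae M I X \<longleftrightarrow> (AE \<omega> in M. continuous_on I (\<lambda>t. X t \<omega>))"

definition path_sup :: "real set \<Rightarrow> (real \<Rightarrow> 'a \<Rightarrow> real) \<Rightarrow> 'a \<Rightarrow> real" where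
  "path_sup I X \<omega> = (SUP t\<in>I. X t \<omega>)"

(* For a process with almost surely continuous paths the supremum over a compact interval
   agrees outside a null set with the supremum over the rational times, but on that null set
   it may be infinite (then SUP is unspecified) or fail to be measurable.  Its expectation is
   therefore taken with respect to the completion of the probability measure. *)
definition expected_sup :: "'a measure \<Rightarrow> real set \<Rightarrow> (real \<Rightarrow> 'a \<Rightarrow> real) \<Rightarrow> real" where
  "expected_sup M I X = (LINT \<omega>|completion M. path_sup I X \<omega>)"

definition integrable_sup :: "'a measure \<Rightarrow> real set \<Rightarrow> (real \<Rightarrow> 'a \<Rightarrow> real) \<Rightarrow> bool" where
  "integrable_sup M I X \<longleftrightarrow> integrable (completion M) (path_sup I X)"

end

theory Submission
  imports Defs
begin

text \<open>Both inequalities are instances of the Sudakov--Fernique comparison: the increments satisfy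
  \<open>2 powr (-K) * \<bar>s - t\<bar> powr (2 * H * K) \<le> E (W s - W t)\<^sup>2 \<le> 2 powr (1 - K) * \<bar>s - t\<bar> powr (2 * H * K)\<close>,
  and the two outer terms are the increment variances of \<open>Y2\<close> and \<open>Y1\<close>.  The upper bound is the
  concavity of \<open>x powr K\<close>.  For the lower bound, \<open>\<bar>t powr H - s powr H\<bar> \<le> \<bar>t - s\<bar> powr H\<close>
  reduces it to an inequality in \<open>p = t powr H\<close> and \<open>q = s powr H\<close>, which becomes
  \<open>2 \<le> (1 + r) powr K + (1 - r) powr K + (1 - w) powr K\<close> on the circle \<open>r\<^sup>2 + w\<^sup>2 = 1\<close> after
  normalising \<open>p\<^sup>2 + q\<^sup>2\<close>.

  The comparison of expected maxima over a finite set replaces the maximum by the log-sum-exp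
  function and the derivative of the Gaussian interpolation by Lindeberg's exchange of small
  independent summands, so that only moments and the uniqueness of joint laws with given
  characteristic function are used.  Chaining along dyadic grids bounds the expected maxima, and
  monotone convergence passes to the supremum over \<open>{0..T}\<close>.\<close>

section \<open>Increment variances\<close>

text \<open>Slepian's inequality is out of reach, since it asks for equal variances: at time
  \<open>t\<close> the variance of \<open>W\<close> is \<open>t powr (2 * H * K)\<close>, whereas
  \<open>Y1\<close> and \<open>Y2\<close> carry the extra factors \<open>2 powr (1 - K)\<close> and
  \<open>2 powr (- K)\<close>. Only the increments are ordered, and for expectations this is enough.
  The reason is that the Hessian of log-sum-exp annihilates constant vectors: the softmax weights
  sum to 1, so its quadratic form is a nonnegatively weighted sum of
  \<open>(v i - v j)\<^sup>2\<close>, and the second-order terms see nothing but increment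
  variances.

  The two processes live on unrelated probability spaces, and no Gaussian vector with a prescribed
  covariance is constructed. Every vector of the interpolation is a linear combination of
  \<open>X\<close> and \<open>Y\<close> on products of these spaces; the uniqueness of joint laws
  identifies it with the sum of independent copies that it stands for.\<close>

lemma powr_sum_ge_quadratic:
  fixes K r :: real
  assumes "0 < K" "K \<le> 1" "0 \<le> r" "r \<le> 1"
  shows "2 - (2 - 2 powr K) * r\<^sup>2 \<le> (1 + r) powr K + (1 - r) powr K"
proof (cases "r = 0 \<or> r = 1")
  case True
  then show ?thesis using assms by auto
next
  case False
  then have r: "0 < r" "r < 1" using assms by auto
  \<comment> \<open>The factor \<open>2 - 2 powr K\<close> is chosen so that \<open>h 1 = 0\<close>;
    also \<open>h 0 = 0\<close>. The derivative of \<open>h\<close> is linear minus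
    \<open>K * \<psi>\<close>, with \<open>\<psi>\<close> convex and \<open>\<psi> 0 = 0\<close>, so
    \<open>h' x / x\<close> is nonincreasing. Hence \<open>h\<close> cannot fall and then rise
    again, as a negative value at \<open>r\<close> would force it to.\<close>
  define h where "h x = (1 + x) powr K + (1 - x) powr K + (2 - 2 powr K) * x\<^sup>2 - 2" for x :: real
  define \<psi> where "\<psi> x = (1 - x) powr (K - 1) - (1 + x) powr (K - 1)" for x :: real
  define h' where "h' x = 2 * (2 - 2 powr K) * x - K * \<psi> x" for x
  have dh: "(h has_real_derivative h' x) (at x)"
    if "0 < x" "x < 1" for x
    unfolding h_def \<psi>_def h'_def using that
    by (auto intro!: derivative_eq_intros simp: algebra_simps)
  have cont: "continuous_on {a..b} h" if "0 \<le> a" "b \<le> 1" for a b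
    unfolding h_def using that assms by (intro continuous_intros continuous_on_powr') auto
  have convex: "convex_on {0..d} \<psi>" if "d < 1" for d
  proof (rule f''_ge0_imp_convex)
    fix x assume x: "x \<in> {0..d}"
    show "(\<psi> has_real_derivative (1 - K) * ((1 - x) powr (K - 2) + (1 + x) powr (K - 2))) (at x)"
      unfolding \<psi>_def using x that
      by (auto intro!: derivative_eq_intros simp: algebra_simps)
    show "((\<lambda>x. (1 - K) * ((1 - x) powr (K - 2) + (1 + x) powr (K - 2))) has_real_derivative
        (1 - K) * (2 - K) * ((1 - x) powr (K - 3) - (1 + x) powr (K - 3))) (at x)"
      using x that by (auto intro!: derivative_eq_intros simp: algebra_simps)
    have "(1 + x) powr (K - 3) \<le> (1 - x) powr (K - 3)"
      using x that assms by (intro powr_mono2') auto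
    then show "0 \<le> (1 - K) * (2 - K) * ((1 - x) powr (K - 3) - (1 + x) powr (K - 3))"
      using assms by simp
  qed auto
  have "0 \<le> h r"
  proof (rule ccontr)
    assume "\<not> 0 \<le> h r"
    then have neg: "h r < 0" by simp
    have "\<exists>l z. 0 < z \<and> z < r \<and> DERIV h z :> l \<and> h r - h 0 = (r - 0) * l"
      using r cont by (intro MVT) (auto simp: real_differentiable_def intro!: exI[of _ "h' _"] dh)
    then obtain c where c: "0 < c" "c < r" "h r - h 0 = r * h' c"
      using r dh by (metis DERIV_unique diff_zero less_trans)
    have "\<exists>l z. r < z \<and> z < 1 \<and> DERIV h z :> l \<and> h 1 - h r = (1 - r) * l"
      using r cont by (intro MVT) (auto simp: real_differentiable_def intro!: exI[of _ "h' _"] dh)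
    then obtain d where d: "r < d" "d < 1" "h 1 - h r = (1 - r) * h' d"
      using r dh by (metis DERIV_unique less_trans)
    have "h 0 = 0" "h 1 = 0" by (auto simp: h_def)
    then have "r * h' c < 0" "0 < (1 - r) * h' d"
      using c(3) d(3) neg by linarith+
    then have c': "h' c < 0" and d': "0 < h' d"
      using r by (auto simp: zero_less_mult_iff mult_less_0_iff)
    \<comment> \<open>Convexity along the chord from 0 to \<open>d\<close>, with
      \<open>\<psi> 0 = 0\<close>, gives \<open>\<psi> c / c \<le> \<psi> d / d\<close>. Therefore
      \<open>h' d / d \<le> h' c / c\<close>, against the signs just found.\<close>
    have "\<psi> ((1 - c/d) *\<^sub>R 0 + (c/d) *\<^sub>R d) \<le> (1 - c/d) * \<psi> 0 + (c/d) * \<psi> d"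
      using c d by (intro convex_onD[OF convex[OF d(2)]]) auto
    then have "d * \<psi> c \<le> c * \<psi> d"
      using c d by (simp add: \<psi>_def field_simps)
    then have "K * (d * \<psi> c) \<le> K * (c * \<psi> d)" using assms by (intro mult_left_mono) auto
    then have "c * h' d \<le> d * h' c" by (simp add: h'_def algebra_simps)
    moreover have "0 < c * h' d" "d * h' c < 0" using c d c' d' by (auto simp: mult_less_0_iff)
    ultimately show False by simp
  qed
  then show ?thesis by (simp add: h_def)
qed

text \<open>By the quadratic bound it remains to absorb \<open>(2 - 2 powr K) * r\<^sup>2\<close> in
  \<open>(1 - w) powr K\<close>. On the circle \<open>r\<^sup>2 = (1 - w) * (1 + w)\<close>, and
  \<open>1 + w\<close> is split into its powers \<open>K\<close> and \<open>1 - K\<close>. The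
  first, times \<open>2 - 2 powr K\<close>, is at most 1 because
  \<open>(2 powr K - 1)\<^sup>2 \<ge> 0\<close>; the second is at most
  \<open>(1 - w) powr (K - 1)\<close> because \<open>(1 + w) * (1 - w) \<le> 1\<close>.\<close>

lemma powr_circle_ge_2:
  fixes K r w :: real
  assumes "0 < K" "K \<le> 1" "0 \<le> r" "0 \<le> w" "r\<^sup>2 + w\<^sup>2 = 1"
  shows "2 \<le> (1 + r) powr K + (1 - r) powr K + (1 - w) powr K"
proof (cases "w < 1")
  case False
  then have "w = 1 \<and> r = 0"
  proof -
    have "1 * 1 \<le> w * w" using False by (intro mult_mono) auto
    then have "r\<^sup>2 = 0" "w\<^sup>2 = 1"
      using assms(5) zero_le_power2[of r] unfolding power2_eq_square by linarith+
    then show ?thesis using assms(4) power2_eq_1_iff[of w] by auto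
  qed
  then show ?thesis by simp
next
  case True
  have rr: "r\<^sup>2 = (1 - w) * (1 + w)" using assms(5) by (simp add: algebra_simps power2_eq_square)
  have "r \<le> 1"
  proof -
    have "r\<^sup>2 \<le> 1" using assms(5) zero_le_power2[of w] by linarith
    then show ?thesis by (simp add: abs_square_le_1)
  qed
  then have 1: "2 - (2 - 2 powr K) * r\<^sup>2 \<le> (1 + r) powr K + (1 - r) powr K"
    using assms by (intro powr_sum_ge_quadratic)
  have "0 \<le> (2 powr K - 1)\<^sup>2" by simp
  then have z: "(2 - 2 powr K) * 2 powr K \<le> 1" by (simp add: power2_eq_square algebra_simps)
  have nn: "0 \<le> 2 - 2 powr K"
    using powr_mono[of K 1 2] assms by simp
  have "(1 + w) powr K \<le> 2 powr K" using assms True by (intro powr_mono2) auto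
  then have z2: "(2 - 2 powr K) * (1 + w) powr K \<le> 1"
    using z nn by (meson mult_left_mono order_trans)
  have "1 + w \<le> inverse (1 - w)"
    using True by (simp add: field_simps)
  then have "(1 + w) powr (1 - K) \<le> inverse (1 - w) powr (1 - K)"
    using assms by (intro powr_mono2) auto
  also have "\<dots> = (1 - w) powr (K - 1)"
    using True by (simp add: inverse_powr flip: powr_minus)
  finally have z3: "(1 + w) powr (1 - K) \<le> (1 - w) powr (K - 1)" .
  have "(2 - 2 powr K) * r\<^sup>2 = ((2 - 2 powr K) * (1 + w) powr K) * ((1 + w) powr (1 - K) * (1 - w))"
    using assms by (simp add: rr powr_diff)
  also have "\<dots> \<le> 1 * ((1 - w) powr (K - 1) * (1 - w))"
    using z2 z3 nn True assms by (intro mult_mono mult_right_mono) auto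
  also have "\<dots> = (1 - w) powr K" using True by (simp add: powr_diff)
  finally show ?thesis using 1 by simp
qed

lemma powr_midpoint_defect_le:
  fixes K p q :: real
  assumes "0 < K" "K \<le> 1" "0 \<le> q" "q \<le> p"
  shows "2 * (p\<^sup>2 + q\<^sup>2) powr K \<le> (2 * p\<^sup>2) powr K + (2 * q\<^sup>2) powr K + ((p - q)\<^sup>2) powr K"
proof (cases "p = 0")
  case True
  then show ?thesis using assms by simp
next
  case False
  define m where "m = p\<^sup>2 + q\<^sup>2"
  have m: "0 < m" using False by (simp add: m_def sum_power2_gt_zero_iff)
  \<comment> \<open>If \<open>(p, q)\<close> has polar angle \<theta>, then \<open>r\<close> and
    \<open>w\<close> are the cosine and sine of 2\<theta>; the three squares become \<open>m\<close>
    times \<open>1 + r\<close>, \<open>1 - r\<close> and \<open>1 - w\<close>, and the claim is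
    homogeneous in \<open>m\<close>.\<close>
  define r where "r = (p\<^sup>2 - q\<^sup>2) / m"
  define w where "w = 2 * p * q / m"
  have "r\<^sup>2 + w\<^sup>2 = ((p\<^sup>2 - q\<^sup>2)\<^sup>2 + (2 * p * q)\<^sup>2) / m\<^sup>2"
    by (simp add: r_def w_def power_divide add_divide_distrib)
  also have "(p\<^sup>2 - q\<^sup>2)\<^sup>2 + (2 * p * q)\<^sup>2 = m\<^sup>2"
    by (simp add: m_def power2_eq_square algebra_simps)
  finally have rw: "r\<^sup>2 + w\<^sup>2 = 1" using m by simp
  have r0: "0 \<le> r" using m assms by (simp add: r_def)
  have w0: "0 \<le> w" using m assms by (simp add: w_def)
  have rl: "r \<le> 1" using m by (simp add: r_def m_def)
  have wl: "w \<le> 1"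
  proof -
    have "w\<^sup>2 \<le> 1" using rw zero_le_power2[of r] by linarith
    then show ?thesis by (simp add: abs_square_le_1)
  qed
  have e: "2 * p\<^sup>2 = m * (1 + r)" "2 * q\<^sup>2 = m * (1 - r)" "(p - q)\<^sup>2 = m * (1 - w)"
    using m by (simp_all add: r_def w_def field_simps) (simp_all add: m_def power2_eq_square algebra_simps)
  have "m powr K * 2 \<le> m powr K * ((1 + r) powr K + (1 - r) powr K + (1 - w) powr K)"
    using powr_circle_ge_2[OF assms(1,2) r0 w0 rw] by (intro mult_left_mono) auto
  then show ?thesis
    unfolding e m_def[symmetric] powr_mult[of m "1 + r"] powr_mult[of m "1 - r"] powr_mult[of m "1 - w"]
    by (simp only: distrib_left mult.commute)
qed

text \<open>On the unit interval \<open>x \<le> x powr H\<close>; this is applied to the shares of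
  \<open>a\<close> and \<open>b\<close> in \<open>a + b\<close>, which add up to 1.\<close>

lemma powr_subadditive:
  fixes H a b :: real
  assumes "0 < H" "H \<le> 1" "0 \<le> a" "0 \<le> b"
  shows "(a + b) powr H \<le> a powr H + b powr H"
proof (cases "a + b = 0")
  case True
  then show ?thesis using assms by simp
next
  case False
  define c where "c = a + b"
  have c: "0 < c" using False assms by (simp add: c_def)
  have *: "x / c \<le> (x / c) powr H" if "0 \<le> x" "x \<le> c" for x
    using powr_mono'[of H 1 "x / c"] assms that c by (cases "x = 0") auto
  have "1 = a / c + b / c" using c by (simp add: c_def flip: add_divide_distrib)
  also have "\<dots> \<le> (a / c) powr H + (b / c) powr H"
    using assms by (intro add_mono *) (auto simp: c_def)
  finally show ?thesis
    using c assms by (simp add: powr_divide c_def[symmetric] field_simps)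
qed

text \<open>The variance of \<open>X s - X t\<close> for a centered process with covariance
  \<open>C\<close>. Both mixed terms occur, so that symmetry of \<open>C\<close> need not be
  assumed.\<close>

definition increment_var :: "('i \<Rightarrow> 'i \<Rightarrow> real) \<Rightarrow> 'i \<Rightarrow> 'i \<Rightarrow> real" where
  "increment_var C s t = C s s + C t t - C s t - C t s"

lemma increment_var_bifractional:
  assumes "0 < H" "0 < K" "0 \<le> s" "0 \<le> t"
  shows "2 powr K * increment_var (bifractional_cov H K) s t =
    (2 * t powr (2 * H)) powr K + (2 * s powr (2 * H)) powr K
      - 2 * (t powr (2 * H) + s powr (2 * H)) powr K + 2 * \<bar>s - t\<bar> powr (2 * H * K)"
  using assms unfolding increment_var_def bifractional_cov_def
  by (simp add: field_simps abs_minus_commute flip: mult_2)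

lemma increment_var_bifractional_le:
  assumes "0 < H" "0 < K" "K \<le> 1" "0 \<le> s" "0 \<le> t"
  shows "increment_var (bifractional_cov H K) s t \<le> 2 powr (1 - K) * \<bar>s - t\<bar> powr (2 * H * K)"
proof -
  define a b where "a = 2 * t powr (2 * H)" and "b = 2 * s powr (2 * H)"
  define m where "m = t powr (2 * H) + s powr (2 * H)"
  have ab: "0 \<le> a" "0 \<le> b" "0 \<le> m" "a + b = 2 * m" by (auto simp: a_def b_def m_def)
  \<comment> \<open>Concavity enters through the tangent at 1, which is Young's inequality with
    second argument 1. Division by the midpoint \<open>m\<close> turns \<open>a\<close> and
    \<open>b\<close> into two numbers with mean 1, whose tangent values add up to 2.\<close>
  have tangent: "x powr K \<le> K * x + (1 - K)" if "0 \<le> x" for x :: real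
    using Youngs_inequality_0[of K "1 - K" x 1] that assms by (cases "x = 0") auto
  have "a powr K + b powr K \<le> 2 * m powr K"
  proof (cases "m = 0")
    case True
    then have "a = 0" "b = 0" using ab by linarith+
    then show ?thesis by simp
  next
    case False
    then have m: "0 < m" using ab by simp
    have "a / m + b / m = 2" using ab m by (simp flip: add_divide_distrib)
    then have "K * (a / m) + K * (b / m) = K * 2" by (metis distrib_left)
    then have "(a / m) powr K + (b / m) powr K \<le> 2"
      using tangent[of "a / m"] tangent[of "b / m"] ab m by simp
    then show ?thesis using m ab by (simp add: powr_divide field_simps)
  qed
  then have "a powr K + b powr K \<le> 2 * (t powr (2 * H) + s powr (2 * H)) powr K"
    by (simp add: a_def b_def m_def)
  then have "2 powr K * increment_var (bifractional_cov H K) s t \<le> 2 * \<bar>s - t\<bar> powr (2 * H * K)"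
    using increment_var_bifractional[of H K s t] assms by (simp add: a_def b_def)
  then show ?thesis by (simp add: powr_diff field_simps)
qed

text \<open>The increment identity contains \<open>\<bar>s - t\<bar> powr (2 * H * K)\<close> twice.
  The concavity defect of \<open>x powr K\<close> costs at most one of these copies and the other
  remains; dropping the defect altogether leaves both. This is where \<open>2 powr (- K)\<close> and
  \<open>2 powr (1 - K)\<close> come from.\<close>

lemma increment_var_bifractional_ge:
  assumes "0 < H" "H \<le> 1" "0 < K" "K \<le> 1" "0 \<le> s" "0 \<le> t"
  shows "2 powr (- K) * \<bar>s - t\<bar> powr (2 * H * K) \<le> increment_var (bifractional_cov H K) s t"
proof -
  have main: "2 * (t powr (2 * H) + s powr (2 * H)) powr K - (2 * t powr (2 * H)) powr K
      - (2 * s powr (2 * H)) powr K \<le> \<bar>s - t\<bar> powr (2 * H * K)"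
    if "0 \<le> s" "s \<le> t" for s t :: real
  proof -
    define p q where "p = t powr H" and "q = s powr H"
    have pq: "t powr (2 * H) = p\<^sup>2" "s powr (2 * H) = q\<^sup>2"
      by (simp_all add: p_def q_def power2_eq_square flip: powr_add)
    have q: "0 \<le> q" "q \<le> p" using that assms by (auto simp: p_def q_def intro!: powr_mono2)
    have "p - q \<le> (t - s) powr H"
      using powr_subadditive[of H s "t - s"] assms that by (simp add: p_def q_def)
    then have "(p - q)\<^sup>2 \<le> ((t - s) powr H)\<^sup>2" using q by (intro power_mono) auto
    also have "\<dots> = (t - s) powr (2 * H)" by (simp add: power2_eq_square flip: powr_add)
    finally have "((p - q)\<^sup>2) powr K \<le> ((t - s) powr (2 * H)) powr K"
      using assms by (intro powr_mono2) auto
    then show ?thesis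
      using powr_midpoint_defect_le[OF assms(3,4) q] that by (simp add: pq powr_powr)
  qed
  have "2 * (t powr (2 * H) + s powr (2 * H)) powr K - (2 * t powr (2 * H)) powr K
      - (2 * s powr (2 * H)) powr K \<le> \<bar>s - t\<bar> powr (2 * H * K)"
    using main[of s t] main[of t s] assms by (cases "s \<le> t") (auto simp: abs_minus_commute add.commute)
  then have "\<bar>s - t\<bar> powr (2 * H * K) \<le> 2 powr K * increment_var (bifractional_cov H K) s t"
    using increment_var_bifractional[of H K s t] assms by simp
  then show ?thesis by (simp add: powr_minus field_simps)
qed

lemma increment_var_fractional:
  assumes "0 < h" "0 \<le> s" "0 \<le> t"
  shows "increment_var (fractional_cov h) s t = \<bar>s - t\<bar> powr (2 * h)"
  using assms unfolding increment_var_def fractional_cov_def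
  by (simp add: field_simps abs_minus_commute)

section \<open>Centered Gaussian variables\<close>

lemma integrable_std_normal_distribution_abs_moment:
  "integrable std_normal_distribution (\<lambda>x. \<bar>x\<bar> ^ k)"
  by (subst integrable_density) (auto simp: integrable_std_normal_moment_abs)

lemma centered_gaussian_rv_distr:
  assumes "prob_space M" "gaussian_rv M X" "(LINT \<omega>|M. X \<omega>) = 0"
  obtains \<sigma> where "0 \<le> \<sigma>" "distr M borel X = distr std_normal_distribution borel (\<lambda>z. \<sigma> * z)"
proof -
  interpret prob_space M by fact
  interpret S: prob_space std_normal_distribution by (rule prob_space_normal_density) simp
  have X [measurable]: "X \<in> borel_measurable M" using assms by (simp add: gaussian_rv_def)
  consider \<mu> where "AE \<omega> in M. X \<omega> = \<mu>"
    | \<mu> \<sigma> where "0 < \<sigma>" "distributed M lborel X (normal_density \<mu> \<sigma>)"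
    using assms(2) by (auto simp: gaussian_rv_def)
  then show ?thesis
  proof cases
    case 1
    then have "(LINT \<omega>|M. X \<omega>) = (LINT \<omega>|M. \<mu>)" by (intro integral_cong_AE) auto
    then have "\<mu> = 0" using assms(3) prob_space by simp
    with 1 have ae: "AE \<omega> in M. X \<omega> = 0" by simp
    have "distr M borel X = distr M borel (\<lambda>_. 0)"
      using ae by (intro distr_cong_AE) auto
    also have "\<dots> = return borel 0" by (intro distr_const) auto
    also have "\<dots> = distr std_normal_distribution borel (\<lambda>z. 0 * z)"
      using S.distr_const[of "0::real" borel] by simp
    finally show ?thesis using that[of 0] by simp
  next
    case 2
    have "(LINT \<omega>|M. X \<omega>) = \<mu>" using normal_distributed_expectation[OF 2] .
    then have \<mu>: "\<mu> = 0" using assms(3) by simp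
    have "distributed M lborel (\<lambda>x. X x / \<sigma>) std_normal_density"
      using 2 normal_standard_normal_convert[of \<sigma> X 0] \<mu> by simp
    then have d: "distr M lborel (\<lambda>x. X x / \<sigma>) = std_normal_distribution"
      by (simp add: distributed_def)
    have "distr M borel X = distr M borel (\<lambda>x. \<sigma> * (X x / \<sigma>))" using 2 by simp
    also have "\<dots> = distr (distr M lborel (\<lambda>x. X x / \<sigma>)) borel (\<lambda>z. \<sigma> * z)"
      by (subst distr_distr) (auto simp: comp_def)
    finally show ?thesis using that[of \<sigma>] 2(1) unfolding d by simp
  qed
qed

definition abs_normal_moment :: "nat \<Rightarrow> real" where
  "abs_normal_moment k = (LINT z|std_normal_distribution. \<bar>z\<bar> ^ k)"

lemma abs_normal_moment_nonneg: "0 \<le> abs_normal_moment k"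
  unfolding abs_normal_moment_def by (intro integral_nonneg_AE) auto

lemma centered_gaussian_rv_facts:
  assumes "prob_space M" "gaussian_rv M X" "(LINT \<omega>|M. X \<omega>) = 0"
  shows centered_gaussian_integrable_abs_moment: "integrable M (\<lambda>\<omega>. \<bar>X \<omega>\<bar> ^ k)"
    and centered_gaussian_abs_moment: "(LINT \<omega>|M. \<bar>X \<omega>\<bar> ^ k) = abs_normal_moment k * sqrt (LINT \<omega>|M. (X \<omega>)\<^sup>2) ^ k"
    and centered_gaussian_char: "(CLINT \<omega>|M. iexp (X \<omega>)) = exp (- (LINT \<omega>|M. (X \<omega>)\<^sup>2) / 2)"
proof -
  have X [measurable]: "X \<in> borel_measurable M" using assms by (simp add: gaussian_rv_def)
  obtain \<sigma> where \<sigma>: "0 \<le> \<sigma>" "distr M borel X = distr std_normal_distribution borel (\<lambda>z. \<sigma> * z)"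
    using centered_gaussian_rv_distr[OF assms] .
  have int: "integrable M (\<lambda>\<omega>. g (X \<omega>)) \<longleftrightarrow> integrable std_normal_distribution (\<lambda>z. g (\<sigma> * z))"
    if [measurable]: "g \<in> borel_measurable borel" for g :: "real \<Rightarrow> real"
    using integrable_distr_eq[of X M borel g] integrable_distr_eq[of "\<lambda>z. \<sigma> * z" std_normal_distribution borel g] \<sigma>
    by simp
  have eq: "(LINT \<omega>|M. g (X \<omega>)) = (LINT z|std_normal_distribution. g (\<sigma> * z))"
    if [measurable]: "g \<in> borel_measurable borel" for g :: "real \<Rightarrow> real"
    using integral_distr[of X M borel g] integral_distr[of "\<lambda>z. \<sigma> * z" std_normal_distribution borel g] \<sigma>
    by simp
  have ceq: "(CLINT \<omega>|M. iexp (X \<omega>)) = (CLINT z|std_normal_distribution. iexp (\<sigma> * z))"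
    using integral_distr[of X M borel iexp] integral_distr[of "\<lambda>z. \<sigma> * z" std_normal_distribution borel iexp] \<sigma>
    by simp
  have 2: "(LINT \<omega>|M. (X \<omega>)\<^sup>2) = \<sigma>\<^sup>2"
    using eq[of "\<lambda>x. x\<^sup>2"] std_normal_distribution_even_moments(1)[of 1] by (simp add: power_mult_distrib fact_numeral)
  show "integrable M (\<lambda>\<omega>. \<bar>X \<omega>\<bar> ^ k)"
    using int[of "\<lambda>x. \<bar>x\<bar> ^ k"] integrable_std_normal_distribution_abs_moment[of k]
    by (simp add: abs_mult power_mult_distrib)
  show "(LINT \<omega>|M. \<bar>X \<omega>\<bar> ^ k) = abs_normal_moment k * sqrt (LINT \<omega>|M. (X \<omega>)\<^sup>2) ^ k"
    using eq[of "\<lambda>x. \<bar>x\<bar> ^ k"] \<sigma> unfolding 2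
    by (simp add: abs_mult power_mult_distrib abs_normal_moment_def)
  show "(CLINT \<omega>|M. iexp (X \<omega>)) = exp (- (LINT \<omega>|M. (X \<omega>)\<^sup>2) / 2)"
    unfolding 2 ceq using fun_cong[OF char_std_normal_distribution, of \<sigma>] by (simp add: char_def)
qed

section \<open>Uniqueness of joint distributions\<close>

text \<open>The laws of \<open>X\<close> and \<open>Y\<close> weighted by \<open>w\<close> and
  \<open>w'\<close> are finite measures with the same Fourier transform. Its value at
  \<open>u = 0\<close> is their common mass \<open>m\<close>; division by \<open>m\<close> makes
  Levy's theorem for probability laws applicable, and for \<open>m = 0\<close> both weights vanish
  almost surely.\<close>

lemma weighted_distribution_unique:
  fixes w :: "'a \<Rightarrow> real" and w' :: "'b \<Rightarrow> real"
  assumes "prob_space M" "prob_space N"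
    and [measurable]: "w \<in> borel_measurable M" "X \<in> borel_measurable M"
      "w' \<in> borel_measurable N" "Y \<in> borel_measurable N" "A \<in> sets borel"
    and w: "\<And>\<omega>. 0 \<le> w \<omega>" "\<And>\<omega>. w \<omega> \<le> b" and w': "\<And>\<omega>. 0 \<le> w' \<omega>" "\<And>\<omega>. w' \<omega> \<le> b"
    and char: "\<And>u. (CLINT \<omega>|M. w \<omega> * iexp (u * X \<omega>)) = (CLINT \<omega>|N. w' \<omega> * iexp (u * Y \<omega>))"
  shows "(LINT \<omega>|M. w \<omega> * indicator A (X \<omega>)) = (LINT \<omega>|N. w' \<omega> * indicator A (Y \<omega>))"
proof -
  interpret M: prob_space M by fact
  interpret N: prob_space N by fact
  have iM: "integrable M w" using w by (intro M.integrable_const_bound[of _ b]) auto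
  have iN: "integrable N w'" using w' by (intro N.integrable_const_bound[of _ b]) auto
  define m where "m = (LINT \<omega>|M. w \<omega>)"
  have m': "(LINT \<omega>|N. w' \<omega>) = m" using char[of 0] by (simp add: m_def)
  have m0: "0 \<le> m" unfolding m_def using w by (intro integral_nonneg_AE) auto
  show ?thesis
  proof (cases "m = 0")
    case True
    have "AE \<omega> in M. w \<omega> = 0"
      using integral_nonneg_eq_0_iff_AE[OF iM] w True by (simp add: m_def)
    moreover have "AE \<omega> in N. w' \<omega> = 0"
      using integral_nonneg_eq_0_iff_AE[OF iN] w' True m' by simp
    ultimately have "(LINT \<omega>|M. w \<omega> * indicator A (X \<omega>)) = (LINT \<omega>|M. 0)"
      "(LINT \<omega>|N. w' \<omega> * indicator A (Y \<omega>)) = (LINT \<omega>|N. 0)"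
      by (intro integral_cong_AE; force)+
    then show ?thesis by simp
  next
    case False
    then have m: "0 < m" using m0 by simp
    define \<mu> where "\<mu> = distr (density M (\<lambda>\<omega>. w \<omega> / m)) borel X"
    define \<nu> where "\<nu> = distr (density N (\<lambda>\<omega>. w' \<omega> / m)) borel Y"
    have "emeasure (density M (\<lambda>\<omega>. w \<omega> / m)) (space M) = 1"
      using w m iM by (simp add: emeasure_density nn_integral_eq_integral m_def cong: nn_integral_cong_simp)
    then have pM: "prob_space (density M (\<lambda>\<omega>. w \<omega> / m))" by (intro prob_spaceI) simp
    have "emeasure (density N (\<lambda>\<omega>. w' \<omega> / m)) (space N) = 1"
      using w' m iN m' by (simp add: emeasure_density nn_integral_eq_integral cong: nn_integral_cong_simp)
    then have pN: "prob_space (density N (\<lambda>\<omega>. w' \<omega> / m))" by (intro prob_spaceI) simp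
    have rd: "real_distribution \<mu>" "real_distribution \<nu>"
      unfolding \<mu>_def \<nu>_def
      by (auto intro!: prob_space.prob_space_distr[OF pM] prob_space.prob_space_distr[OF pN] simp: real_distribution_def real_distribution_axioms_def)
    have "char \<mu> u = char \<nu> u" for u
    proof -
      have "char \<mu> u = (CLINT \<omega>|M. (w \<omega> * iexp (u * X \<omega>)) / m)"
        unfolding char_def \<mu>_def using w m
        by (simp add: integral_distr integral_density scaleR_conv_of_real)
      moreover have "char \<nu> u = (CLINT \<omega>|N. (w' \<omega> * iexp (u * Y \<omega>)) / m)"
        unfolding char_def \<nu>_def using w' m
        by (simp add: integral_distr integral_density scaleR_conv_of_real)
      ultimately show ?thesis using char[of u] by simp
    qed
    then have eq: "\<mu> = \<nu>" using rd by (intro Levy_uniqueness) auto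
    have "(LINT x|\<mu>. indicator A x) = (LINT \<omega>|M. (w \<omega> * indicator A (X \<omega>)) / m)"
      unfolding \<mu>_def using w m by (subst integral_distr, simp, simp, subst integral_density) auto
    moreover have "(LINT x|\<nu>. indicator A x) = (LINT \<omega>|N. (w' \<omega> * indicator A (Y \<omega>)) / m)"
      unfolding \<nu>_def using w' m by (subst integral_distr, simp, simp, subst integral_density) auto
    ultimately show ?thesis using eq m by simp
  qed
qed

text \<open>The coordinates are turned from characters into indicators one at a time.  The nonnegative
  weights \<open>1 + cos (\<theta> - \<alpha>)\<close> make the remaining exponential part of a positive measure on the line,
  so that the one-dimensional uniqueness theorem applies; \<open>\<alpha> = 0\<close> and \<open>\<alpha> = pi / 2\<close> recover its
  real and imaginary parts.\<close>

lemma joint_indicator_char_eq: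
  fixes X :: "'i \<Rightarrow> 'a \<Rightarrow> real" and Y :: "'i \<Rightarrow> 'b \<Rightarrow> real"
  assumes "prob_space M" "prob_space N" "finite J"
    and X [measurable]: "\<And>j. j \<in> J \<Longrightarrow> X j \<in> borel_measurable M"
    and Y [measurable]: "\<And>j. j \<in> J \<Longrightarrow> Y j \<in> borel_measurable N"
    and char: "\<And>c. (CLINT \<omega>|M. iexp (\<Sum>j\<in>J. c j * X j \<omega>)) = (CLINT \<omega>|N. iexp (\<Sum>j\<in>J. c j * Y j \<omega>))"
    and "I \<subseteq> J" "\<And>i. i \<in> I \<Longrightarrow> A i \<in> sets borel"
  shows "(CLINT \<omega>|M. (\<Prod>i\<in>I. indicator (A i) (X i \<omega>) :: real) * iexp (\<Sum>j\<in>J. c j * X j \<omega>)) =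
    (CLINT \<omega>|N. (\<Prod>i\<in>I. indicator (A i) (Y i \<omega>) :: real) * iexp (\<Sum>j\<in>J. c j * Y j \<omega>))"
proof -
  interpret M: prob_space M by fact
  interpret N: prob_space N by fact
  have "finite I" using assms(3,7) finite_subset by auto
  then show ?thesis using assms(7,8)
  proof (induction I arbitrary: c rule: finite_induct)
    case empty
    then show ?case using char by simp
  next
    case (insert k I)
    have k: "k \<in> J" and IJ: "\<And>i. i \<in> I \<Longrightarrow> i \<in> J" using insert by auto
    note [measurable] = X[OF k] Y[OF k]
    have A[measurable]: "A k \<in> sets borel" "\<And>i. i \<in> I \<Longrightarrow> A i \<in> sets borel" using insert by auto
    define p where "p \<omega> = (\<Prod>i\<in>I. indicator (A i) (X i \<omega>) :: real)" for \<omega>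
    define q where "q \<omega> = (\<Prod>i\<in>I. indicator (A i) (Y i \<omega>) :: real)" for \<omega>
    have pm[measurable]: "p \<in> borel_measurable M" unfolding p_def by (intro borel_measurable_prod measurable_compose[OF X[OF IJ]]) auto
    have qm[measurable]: "q \<in> borel_measurable N" unfolding q_def by (intro borel_measurable_prod measurable_compose[OF Y[OF IJ]]) auto
    have p01: "0 \<le> p \<omega>" "p \<omega> \<le> 1" for \<omega>
      unfolding p_def by (auto intro!: prod_nonneg prod_le_1)
    have q01: "0 \<le> q \<omega>" "q \<omega> \<le> 1" for \<omega>
      unfolding q_def by (auto intro!: prod_nonneg prod_le_1)
    have IH: "(CLINT \<omega>|M. p \<omega> * iexp (\<Sum>j\<in>J. c j * X j \<omega>)) =
        (CLINT \<omega>|N. q \<omega> * iexp (\<Sum>j\<in>J. c j * Y j \<omega>))" for c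
      unfolding p_def q_def using insert by auto
    have intM: "integrable M (\<lambda>\<omega>. p \<omega> * iexp (\<Sum>j\<in>J. c j * X j \<omega>))" for c
      using p01 by (intro M.integrable_const_bound[of _ 1]) (auto simp: norm_mult)
    have intN: "integrable N (\<lambda>\<omega>. q \<omega> * iexp (\<Sum>j\<in>J. c j * Y j \<omega>))" for c
      using q01 by (intro N.integrable_const_bound[of _ 1]) (auto simp: norm_mult)
    \<comment> \<open>Adding \<open>u * Z k\<close> or rescaling the exponent by \<open>a\<close>
      only changes the coefficients. As the induction hypothesis holds for all coefficients, it
      covers every exponent met below.\<close>
    have shift: "(\<Sum>j\<in>J. (a * c j + (if j = k then u else 0)) * Z j) = u * Z k + a * (\<Sum>j\<in>J. c j * Z j)"
      for a u c and Z :: "'i \<Rightarrow> real"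
      using assms(3) k by (simp add: distrib_right sum.distrib sum_distrib_left mult.assoc
          if_distrib[of "\<lambda>x. x * _"] cong: if_cong)
    have shiftX: "u * X k \<omega> + a * (\<Sum>j\<in>J. c j * X j \<omega>) = (\<Sum>j\<in>J. (a * c j + (if j = k then u else 0)) * X j \<omega>)"
      for a u c \<omega> using shift[of a c u "\<lambda>j. X j \<omega>"] by simp
    have shiftY: "u * Y k \<omega> + a * (\<Sum>j\<in>J. c j * Y j \<omega>) = (\<Sum>j\<in>J. (a * c j + (if j = k then u else 0)) * Y j \<omega>)"
      for a u c \<omega> using shift[of a c u "\<lambda>j. Y j \<omega>"] by simp
    \<comment> \<open>Euler's formula writes the weight \<open>1 + cos (\<theta> - \<alpha>)\<close>
      as three characters with frequencies 0, 1 and -1 in \<theta>. The factors \<open>0\<close>,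
      \<open>1\<close> and \<open>-1\<close> are kept visible because they are the values of
      \<open>a\<close> in the shift.\<close>
    have expand: "complex_of_real (r * (1 + cos (\<theta> - \<alpha>))) * iexp x =
        r * iexp (x + 0 * \<theta>) + (iexp (-\<alpha>) / 2) * (r * iexp (x + 1 * \<theta>)) + (iexp \<alpha> / 2) * (r * iexp (x + (-1) * \<theta>))"
      for r \<theta> \<alpha> x :: real
    proof -
      have cos: "complex_of_real (cos (\<theta> - \<alpha>)) = (iexp (\<theta> - \<alpha>) + iexp (-(\<theta> - \<alpha>))) / 2"
        by (simp only: cos_of_real[symmetric] cos_exp_eq of_real_minus mult_minus_right)
      show ?thesis unfolding of_real_mult of_real_add cos
        by (simp add: exp_diff exp_add exp_minus right_diff_distrib field_simps)
    qed
    have weighted: "(LINT \<omega>|M. p \<omega> * (1 + cos ((\<Sum>j\<in>J. c j * X j \<omega>) - \<alpha>)) * indicator (A k) (X k \<omega>)) =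
      (LINT \<omega>|N. q \<omega> * (1 + cos ((\<Sum>j\<in>J. c j * Y j \<omega>) - \<alpha>)) * indicator (A k) (Y k \<omega>))" for c \<alpha>
    proof (rule weighted_distribution_unique[where b = 2])
      show "(CLINT \<omega>|M. complex_of_real (p \<omega> * (1 + cos ((\<Sum>j\<in>J. c j * X j \<omega>) - \<alpha>))) * iexp (u * X k \<omega>)) =
        (CLINT \<omega>|N. complex_of_real (q \<omega> * (1 + cos ((\<Sum>j\<in>J. c j * Y j \<omega>) - \<alpha>))) * iexp (u * Y k \<omega>))" for u
        unfolding expand shiftX shiftY
        by (simp only: Bochner_Integration.integral_add Bochner_Integration.integrable_add
            integrable_mult_right intM intN integral_mult_right_zero IH)
      have *: "0 \<le> r * (1 + cos x)" "r * (1 + cos x) \<le> 2" if "0 \<le> r" "r \<le> 1" for r x :: real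
      proof -
        have "0 \<le> 1 + cos x" "1 + cos x \<le> 2" using cos_ge_minus_one[of x] cos_le_one[of x] by linarith+
        then show "0 \<le> r * (1 + cos x)" "r * (1 + cos x) \<le> 2"
          using that mult_mono[of r 1 "1 + cos x" 2] by auto
      qed
      show "0 \<le> p \<omega> * (1 + cos ((\<Sum>j\<in>J. c j * X j \<omega>) - \<alpha>))"
        "p \<omega> * (1 + cos ((\<Sum>j\<in>J. c j * X j \<omega>) - \<alpha>)) \<le> 2" for \<omega>
        using p01 by (auto intro: *)
      show "0 \<le> q \<omega> * (1 + cos ((\<Sum>j\<in>J. c j * Y j \<omega>) - \<alpha>))"
        "q \<omega> * (1 + cos ((\<Sum>j\<in>J. c j * Y j \<omega>) - \<alpha>)) \<le> 2" for \<omega>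
        using q01 by (auto intro: *)
    qed (use assms(1,2) in measurable)
    \<comment> \<open>For zero coefficients and \<open>\<alpha> = 0\<close> the weight is the
      constant 2. This isolates the summand 1 of the weight, so that the cosine part can be obtained
      by subtraction.\<close>
    have base: "(LINT \<omega>|M. p \<omega> * indicator (A k) (X k \<omega>)) = (LINT \<omega>|N. q \<omega> * indicator (A k) (Y k \<omega>))"
      using weighted[of "\<lambda>_. 0" 0] by (simp add: mult.assoc mult.left_commute[of _ 2])
    have iM: "integrable M (\<lambda>\<omega>. p \<omega> * indicator (A k) (X k \<omega>) * f \<omega>)"
      if [measurable]: "f \<in> borel_measurable M" and f: "\<And>\<omega>. \<bar>f \<omega>\<bar> \<le> 1" for f
      using p01 f by (intro M.integrable_const_bound[of _ 1])
        (auto simp: abs_mult indicator_def intro!: mult_le_one)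
    have iN: "integrable N (\<lambda>\<omega>. q \<omega> * indicator (A k) (Y k \<omega>) * f \<omega>)"
      if [measurable]: "f \<in> borel_measurable N" and f: "\<And>\<omega>. \<bar>f \<omega>\<bar> \<le> 1" for f
      using q01 f by (intro N.integrable_const_bound[of _ 1])
        (auto simp: abs_mult indicator_def intro!: mult_le_one)
    have iMc: "integrable M (\<lambda>\<omega>. p \<omega> * indicator (A k) (X k \<omega>) * cos ((\<Sum>j\<in>J. c j * X j \<omega>) - \<alpha>))" for c \<alpha>
      by (intro iM) auto
    have iNc: "integrable N (\<lambda>\<omega>. q \<omega> * indicator (A k) (Y k \<omega>) * cos ((\<Sum>j\<in>J. c j * Y j \<omega>) - \<alpha>))" for c \<alpha>
      by (intro iN) auto
    have trig: "(LINT \<omega>|M. p \<omega> * indicator (A k) (X k \<omega>) * cos ((\<Sum>j\<in>J. c j * X j \<omega>) - \<alpha>)) =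
      (LINT \<omega>|N. q \<omega> * indicator (A k) (Y k \<omega>) * cos ((\<Sum>j\<in>J. c j * Y j \<omega>) - \<alpha>))" for \<alpha>
    proof -
      have "(LINT \<omega>|M. p \<omega> * indicator (A k) (X k \<omega>) * 1 + p \<omega> * indicator (A k) (X k \<omega>) * cos ((\<Sum>j\<in>J. c j * X j \<omega>) - \<alpha>)) =
        (LINT \<omega>|N. q \<omega> * indicator (A k) (Y k \<omega>) * 1 + q \<omega> * indicator (A k) (Y k \<omega>) * cos ((\<Sum>j\<in>J. c j * Y j \<omega>) - \<alpha>))"
        using weighted[of c \<alpha>] by (simp add: algebra_simps)
      also have "(LINT \<omega>|M. p \<omega> * indicator (A k) (X k \<omega>) * 1 + p \<omega> * indicator (A k) (X k \<omega>) * cos ((\<Sum>j\<in>J. c j * X j \<omega>) - \<alpha>)) =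
         (LINT \<omega>|M. p \<omega> * indicator (A k) (X k \<omega>) * 1) + (LINT \<omega>|M. p \<omega> * indicator (A k) (X k \<omega>) * cos ((\<Sum>j\<in>J. c j * X j \<omega>) - \<alpha>))"
        by (intro Bochner_Integration.integral_add iM) auto
      also have "(LINT \<omega>|N. q \<omega> * indicator (A k) (Y k \<omega>) * 1 + q \<omega> * indicator (A k) (Y k \<omega>) * cos ((\<Sum>j\<in>J. c j * Y j \<omega>) - \<alpha>)) =
         (LINT \<omega>|N. q \<omega> * indicator (A k) (Y k \<omega>) * 1) + (LINT \<omega>|N. q \<omega> * indicator (A k) (Y k \<omega>) * cos ((\<Sum>j\<in>J. c j * Y j \<omega>) - \<alpha>))"
        by (intro Bochner_Integration.integral_add iN) auto
      finally show ?thesis using base by simp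
    qed
    have iexp: "complex_of_real a * iexp x = of_real (a * cos (x - 0)) + \<i> * of_real (a * cos (x - pi / 2))" for a x :: real
      by (simp add: exp_Euler cos_diff algebra_simps flip: cos_of_real sin_of_real)
    have "(CLINT \<omega>|M. complex_of_real (p \<omega> * indicator (A k) (X k \<omega>)) * iexp (\<Sum>j\<in>J. c j * X j \<omega>)) =
      (CLINT \<omega>|N. complex_of_real (q \<omega> * indicator (A k) (Y k \<omega>)) * iexp (\<Sum>j\<in>J. c j * Y j \<omega>))"
      unfolding iexp
      by (simp only: Bochner_Integration.integral_add integrable_mult_right integrable_of_real iMc iNc
          integral_mult_right_zero integral_complex_of_real trig)
    moreover have "(\<Prod>i\<in>insert k I. indicator (A i) (X i \<omega>) :: real) = p \<omega> * indicator (A k) (X k \<omega>)"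
      "(\<Prod>i\<in>insert k I. indicator (A i) (Y i \<omega>') :: real) = q \<omega>' * indicator (A k) (Y k \<omega>')" for \<omega> \<omega>'
      using insert by (auto simp: p_def q_def)
    ultimately show ?case by simp
  qed
qed

text \<open>Once all coordinates have become indicators and \<open>c = 0\<close>, the preceding
  identity says that both laws agree on measurable boxes, an intersection-stable generator of the
  product sigma-algebra.\<close>

theorem joint_distribution_unique:
  fixes X :: "'i \<Rightarrow> 'a \<Rightarrow> real" and Y :: "'i \<Rightarrow> 'b \<Rightarrow> real"
  assumes "prob_space M" "prob_space N" "finite J"
    and X [measurable]: "\<And>j. j \<in> J \<Longrightarrow> X j \<in> borel_measurable M"
    and Y [measurable]: "\<And>j. j \<in> J \<Longrightarrow> Y j \<in> borel_measurable N"
    and char: "\<And>c. (CLINT \<omega>|M. iexp (\<Sum>j\<in>J. c j * X j \<omega>)) = (CLINT \<omega>|N. iexp (\<Sum>j\<in>J. c j * Y j \<omega>))"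
  shows "distr M (\<Pi>\<^sub>M j\<in>J. borel) (\<lambda>\<omega>. \<lambda>j\<in>J. X j \<omega>) = distr N (\<Pi>\<^sub>M j\<in>J. borel) (\<lambda>\<omega>. \<lambda>j\<in>J. Y j \<omega>)"
    (is "?\<mu> = ?\<nu>")
proof (rule measure_eqI_PiM_finite[OF assms(3), where A = "\<lambda>_. \<Pi>\<^sub>E j\<in>J. UNIV"])
  interpret M: prob_space M by fact
  interpret N: prob_space N by fact
  fix A :: "'i \<Rightarrow> real set" assume A: "\<And>i. i \<in> J \<Longrightarrow> A i \<in> sets borel"
  have indX: "indicator ((\<lambda>\<omega>. \<lambda>j\<in>J. X j \<omega>) -` Pi\<^sub>E J A \<inter> space M) \<omega> = (\<Prod>i\<in>J. indicator (A i) (X i \<omega>) :: real)"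
    if "\<omega> \<in> space M" for \<omega>
    using that assms(3) by (auto simp: indicator_def PiE_iff)
  have indY: "indicator ((\<lambda>\<omega>. \<lambda>j\<in>J. Y j \<omega>) -` Pi\<^sub>E J A \<inter> space N) \<omega> = (\<Prod>i\<in>J. indicator (A i) (Y i \<omega>) :: real)"
    if "\<omega> \<in> space N" for \<omega>
    using that assms(3) by (auto simp: indicator_def PiE_iff)
  have sets: "Pi\<^sub>E J A \<in> sets (\<Pi>\<^sub>M j\<in>J. borel)"
    using A assms(3) by (intro sets_PiM_I_finite) auto
  have "emeasure ?\<mu> (Pi\<^sub>E J A) = ennreal (LINT \<omega>|M. indicator ((\<lambda>\<omega>. \<lambda>j\<in>J. X j \<omega>) -` Pi\<^sub>E J A \<inter> space M) \<omega>)"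
    using sets by (simp add: emeasure_distr M.emeasure_eq_measure)
  also have "(LINT \<omega>|M. indicator ((\<lambda>\<omega>. \<lambda>j\<in>J. X j \<omega>) -` Pi\<^sub>E J A \<inter> space M) \<omega>) = (LINT \<omega>|M. (\<Prod>i\<in>J. indicator (A i) (X i \<omega>) :: real))"
    using indX by (intro Bochner_Integration.integral_cong) auto
  also have "\<dots> = (LINT \<omega>|N. (\<Prod>i\<in>J. indicator (A i) (Y i \<omega>) :: real))"
    using joint_indicator_char_eq[OF assms subset_refl, of A "\<lambda>_. 0"] A
    by (simp add: integral_complex_of_real flip: of_real_prod)
  also have "\<dots> = (LINT \<omega>|N. indicator ((\<lambda>\<omega>. \<lambda>j\<in>J. Y j \<omega>) -` Pi\<^sub>E J A \<inter> space N) \<omega>)"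
    using indY by (intro Bochner_Integration.integral_cong) auto
  also have "ennreal \<dots> = emeasure ?\<nu> (Pi\<^sub>E J A)"
    using sets by (simp add: emeasure_distr N.emeasure_eq_measure)
  finally show "emeasure ?\<mu> (Pi\<^sub>E J A) = emeasure ?\<nu> (Pi\<^sub>E J A)" .
next
  interpret M: prob_space M by fact
  interpret P: prob_space ?\<mu> by (intro M.prob_space_distr) measurable
  show "emeasure ?\<mu> (\<Pi>\<^sub>E j\<in>J. UNIV) \<noteq> \<infinity>" for i :: nat by simp
  show "range (\<lambda>_::nat. \<Pi>\<^sub>E j\<in>J. UNIV) \<subseteq> prod_algebra J (\<lambda>_. borel :: real measure)"
    using assms(3) by (auto intro!: prod_algebraI_finite)
qed (auto simp: space_PiM)

section \<open>The log-sum-exp function\<close>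

definition lse :: "'i set \<Rightarrow> ('i \<Rightarrow> real) \<Rightarrow> real" where
  "lse J x = ln (\<Sum>j\<in>J. exp (x j))"

text \<open>The gradient of \<open>lse J\<close> at \<open>x\<close>, that is, the Gibbs weights for
  the energies \<open>- x j\<close>.\<close>

definition softmax :: "'i set \<Rightarrow> ('i \<Rightarrow> real) \<Rightarrow> 'i \<Rightarrow> real" where
  "softmax J x j = exp (x j) / (\<Sum>i\<in>J. exp (x i))"

lemma lse_ge:
  assumes "finite J" "j \<in> J"
  shows "x j \<le> lse J x"
proof -
  have "exp (x j) \<le> (\<Sum>i\<in>J. exp (x i))" using assms by (intro member_le_sum) auto
  then have "ln (exp (x j)) \<le> lse J x" unfolding lse_def by (intro ln_mono) auto
  then show ?thesis by simp
qed

lemma lse_le: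
  assumes "finite J" "J \<noteq> {}" "\<And>j. j \<in> J \<Longrightarrow> x j \<le> b"
  shows "lse J x \<le> b + ln (card J)"
proof -
  have "(\<Sum>i\<in>J. exp (x i)) \<le> (\<Sum>i\<in>J. exp b)" using assms by (intro sum_mono) auto
  moreover have "0 < (\<Sum>i\<in>J. exp (x i))" using assms by (intro sum_pos) auto
  moreover have "0 < card J" using assms by (simp add: card_gt_0_iff)
  ultimately have "lse J x \<le> ln (card J * exp b)" unfolding lse_def by (intro ln_mono) auto
  then show ?thesis using \<open>0 < card J\<close> by (simp add: ln_mult)
qed

lemma abs_lse_le:
  assumes "finite J" "J \<noteq> {}"
  shows "\<bar>lse J x\<bar> \<le> (\<Sum>j\<in>J. \<bar>x j\<bar>) + ln (card J)"
proof -
  have b: "\<bar>x j\<bar> \<le> (\<Sum>j\<in>J. \<bar>x j\<bar>)" if "j \<in> J" for j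
    using assms that by (intro member_le_sum) auto
  obtain j where j: "j \<in> J" using assms by auto
  have "lse J x \<le> (\<Sum>j\<in>J. \<bar>x j\<bar>) + ln (card J)"
    using assms b by (intro lse_le) (auto intro: order_trans[OF abs_ge_self])
  moreover have "0 < card J" using assms by (simp add: card_gt_0_iff)
  then have "0 \<le> ln (card J)" by simp
  moreover have "x j \<le> lse J x" using assms(1) j by (rule lse_ge)
  ultimately show ?thesis using b[OF j] by linarith
qed

lemma lse_cong: "(\<And>j. j \<in> J \<Longrightarrow> x j = y j) \<Longrightarrow> lse J x = lse J y"
  unfolding lse_def by (metis (mono_tags, lifting) sum.cong)

lemma sum_softmax:
  assumes "finite J" "J \<noteq> {}"
  shows "(\<Sum>j\<in>J. softmax J x j) = 1"
proof -
  have "0 < (\<Sum>i\<in>J. exp (x i))" using assms by (intro sum_pos) auto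
  then show ?thesis by (simp add: softmax_def flip: sum_divide_distrib)
qed

lemma softmax_nonneg: "0 \<le> softmax J x j"
  unfolding softmax_def by (auto intro!: divide_nonneg_nonneg sum_nonneg)

text \<open>The left side is the quadratic form of the Hessian of \<open>lse\<close> when
  \<open>p\<close> is the softmax. Writing it through pairs shows that only differences of
  coordinates enter, and with nonnegative weights; this is why ordered increments suffice for the
  comparison.\<close>

lemma weighted_variance_eq:
  fixes p v :: "'i \<Rightarrow> real"
  assumes "(\<Sum>j\<in>J. p j) = 1"
  shows "(\<Sum>j\<in>J. p j * (v j)\<^sup>2) - (\<Sum>j\<in>J. p j * v j)\<^sup>2 =
    (\<Sum>i\<in>J. \<Sum>j\<in>J. p i * p j * (v i - v j)\<^sup>2) / 2"
proof -
  have "(\<Sum>i\<in>J. \<Sum>j\<in>J. p i * p j * (v i - v j)\<^sup>2) =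
    (\<Sum>i\<in>J. \<Sum>j\<in>J. (p i * (v i)\<^sup>2) * p j) + (\<Sum>i\<in>J. \<Sum>j\<in>J. p i * (p j * (v j)\<^sup>2))
      - 2 * (\<Sum>i\<in>J. \<Sum>j\<in>J. (p i * v i) * (p j * v j))"
    by (simp add: sum_distrib_left flip: sum.distrib sum_subtractf)
      (simp add: power2_eq_square algebra_simps)
  also have "\<dots> = 2 * (\<Sum>j\<in>J. p j * (v j)\<^sup>2) - 2 * (\<Sum>j\<in>J. p j * v j)\<^sup>2"
    using assms by (simp add: power2_eq_square flip: sum_product)
  finally show ?thesis by simp
qed

text \<open>Along \<open>s + \<theta> v\<close> the growth of \<open>lse\<close> is the cumulant
  generating function of \<open>v\<close> under the softmax weights at \<open>s\<close>. Here
  \<open>\<mu> k\<close> is the \<open>k\<close>-th moment under the weights tilted by \<theta>, and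
  \<open>\<kappa> 1\<close>, \<open>\<kappa> 2\<close>, \<open>\<kappa> 3\<close> are the cumulants.
  The factor 1/4 is the 1/2 of the Taylor formula times the 1/2 that turns the sum over pairs into a
  variance.\<close>

lemma lse_second_order:
  fixes s v :: "'i \<Rightarrow> real"
  assumes "finite J" "J \<noteq> {}"
  shows "\<bar>lse J (\<lambda>j. s j + v j) - (lse J s + (\<Sum>j\<in>J. softmax J s j * v j)
      + (\<Sum>i\<in>J. \<Sum>j\<in>J. softmax J s i * softmax J s j * (v i - v j)\<^sup>2) / 4)\<bar> \<le> (\<Sum>j\<in>J. \<bar>v j\<bar>) ^ 3"
proof -
  define V where "V = (\<Sum>j\<in>J. \<bar>v j\<bar>)"
  have V0: "0 \<le> V" unfolding V_def by (intro sum_nonneg) auto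
  have vV: "\<bar>v j\<bar> \<le> V" if "j \<in> J" for j
    unfolding V_def using assms that by (intro member_le_sum) auto
  define m where "m k \<theta> = (\<Sum>j\<in>J. exp (s j + \<theta> * v j) * v j ^ k)" for k :: nat and \<theta> :: real
  have m0: "0 < m 0 \<theta>" for \<theta> unfolding m_def using assms by (auto intro!: sum_pos)
  have dm: "(m k has_real_derivative m (Suc k) \<theta>) (at \<theta>)" for k \<theta>
    unfolding m_def by (auto intro!: derivative_eq_intros sum.cong simp: algebra_simps)
  define \<mu> where "\<mu> k \<theta> = m k \<theta> / m 0 \<theta>" for k \<theta>
  have \<mu>: "\<bar>\<mu> k \<theta>\<bar> \<le> V ^ k" for k \<theta>
  proof -
    have "\<bar>m k \<theta>\<bar> \<le> (\<Sum>j\<in>J. exp (s j + \<theta> * v j) * \<bar>v j\<bar> ^ k)"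
      unfolding m_def by (rule order_trans[OF sum_abs]) (simp add: abs_mult power_abs)
    also have "\<dots> \<le> (\<Sum>j\<in>J. exp (s j + \<theta> * v j) * V ^ k)"
      using vV by (intro sum_mono mult_left_mono power_mono) auto
    also have "\<dots> = m 0 \<theta> * V ^ k" by (simp add: m_def sum_distrib_right)
    finally show ?thesis using m0[of \<theta>] by (simp add: \<mu>_def field_simps)
  qed
  have d\<mu>: "(\<mu> k has_real_derivative \<mu> (Suc k) \<theta> - \<mu> k \<theta> * \<mu> 1 \<theta>) (at \<theta>)" for k \<theta>
    unfolding \<mu>_def using m0[of \<theta>]
    by (auto intro!: derivative_eq_intros dm simp: field_simps power2_eq_square)
  define \<kappa> :: "nat \<Rightarrow> real \<Rightarrow> real" where "\<kappa> = (\<lambda>n \<theta>. if n = 0 then ln (m 0 \<theta>) else if n = 1 then \<mu> 1 \<theta>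
     else if n = 2 then \<mu> 2 \<theta> - (\<mu> 1 \<theta>)\<^sup>2
     else \<mu> 3 \<theta> - 3 * \<mu> 1 \<theta> * \<mu> 2 \<theta> + 2 * \<mu> 1 \<theta> ^ 3)"
  have "(\<kappa> n has_real_derivative \<kappa> (Suc n) \<theta>) (at \<theta>)" if "n < 3" for n \<theta>
  proof -
    have "n = 0 \<or> n = 1 \<or> n = 2" using that by arith
    then consider "n = 0" | "n = 1" | "n = 2" by blast
    then show ?thesis
    proof cases
      case 1
      show ?thesis unfolding 1 \<kappa>_def using m0[of \<theta>]
        by (auto intro!: derivative_eq_intros dm simp: \<mu>_def)
    next
      case 2
      show ?thesis unfolding 2 \<kappa>_def
        using d\<mu>[of 1 \<theta>] by (simp add: power2_eq_square numeral_2_eq_2)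
    next
      case 3
      show ?thesis unfolding 3 \<kappa>_def
        by (auto intro!: derivative_eq_intros d\<mu> simp: power2_eq_square power3_eq_cube numeral_3_eq_3 numeral_2_eq_2 algebra_simps)
    qed
  qed
  then have "\<exists>t>0. t < 1 \<and> \<kappa> 0 1 = (\<Sum>k<3. (\<kappa> k 0 / fact k) * 1 ^ k) + (\<kappa> 3 t / fact 3) * 1 ^ 3"
    by (intro Maclaurin) auto
  then obtain t where t: "\<kappa> 0 1 = (\<Sum>k<3. \<kappa> k 0 / fact k) + \<kappa> 3 t / fact 3" by auto
  have p: "softmax J s j = exp (s j) / m 0 0" for j by (simp add: softmax_def m_def)
  have \<mu>0: "\<mu> k 0 = (\<Sum>j\<in>J. softmax J s j * v j ^ k)" for k
    by (simp add: \<mu>_def p) (simp add: m_def sum_divide_distrib)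
  have "\<kappa> 2 0 = (\<Sum>i\<in>J. \<Sum>j\<in>J. softmax J s i * softmax J s j * (v i - v j)\<^sup>2) / 2"
    using weighted_variance_eq[OF sum_softmax[OF assms], of s v] by (simp add: \<kappa>_def \<mu>0)
  then have "lse J (\<lambda>j. s j + v j) - (lse J s + (\<Sum>j\<in>J. softmax J s j * v j)
      + (\<Sum>i\<in>J. \<Sum>j\<in>J. softmax J s i * softmax J s j * (v i - v j)\<^sup>2) / 4) = \<kappa> 3 t / 6"
  proof -
    have "(\<Sum>k<3. \<kappa> k 0 / fact k) = \<kappa> 0 0 + \<kappa> 1 0 + \<kappa> 2 0 / 2" "fact 3 = (6 :: real)"
      by (simp_all add: eval_nat_numeral)
    moreover have "\<kappa> 0 1 = lse J (\<lambda>j. s j + v j)" "\<kappa> 0 0 = lse J s" "\<kappa> 1 0 = (\<Sum>j\<in>J. softmax J s j * v j)"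
      by (simp_all add: \<kappa>_def \<mu>0 lse_def m_def)
    ultimately show ?thesis using t \<open>\<kappa> 2 0 = _\<close> by simp
  qed
  \<comment> \<open>The coefficients 1, 3 and 2 of the third cumulant add up to 6, which cancels the
    \<open>fact 3\<close> of the remainder.\<close>
  moreover have "\<bar>\<kappa> 3 t\<bar> \<le> 6 * V ^ 3"
  proof -
    have "\<bar>\<mu> 1 t * \<mu> 2 t\<bar> \<le> V ^ 1 * V ^ 2"
      unfolding abs_mult using V0 by (intro mult_mono \<mu>) auto
    moreover have "\<bar>\<mu> 1 t ^ 3\<bar> \<le> V ^ 3"
      unfolding power_abs using \<mu>[of 1 t] by (intro power_mono) auto
    moreover have "\<bar>\<mu> 3 t\<bar> \<le> V ^ 3" by (rule \<mu>)
    moreover have "V ^ 1 * V ^ 2 = V ^ 3" by (simp add: power2_eq_square power3_eq_cube)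
    ultimately show ?thesis by (simp add: \<kappa>_def)
  qed
  ultimately show ?thesis unfolding V_def[symmetric] by linarith
qed

text \<open>Serves to reduce the integrability of the Taylor remainder to third absolute moments of
  single coordinates; the constant is crude, as only finiteness matters.\<close>

lemma sum_abs_cube_le:
  fixes x :: "'i \<Rightarrow> real"
  assumes "finite J"
  shows "(\<Sum>j\<in>J. \<bar>x j\<bar>) ^ 3 \<le> card J ^ 3 * (\<Sum>j\<in>J. \<bar>x j\<bar> ^ 3)"
proof -
  define S where "S = (\<Sum>j\<in>J. \<bar>x j\<bar> ^ 3)"
  have S0: "0 \<le> S" unfolding S_def by (intro sum_nonneg) auto
  have "\<bar>x j\<bar> \<le> root 3 S" if "j \<in> J" for j
  proof -
    have "\<bar>x j\<bar> ^ 3 \<le> S" unfolding S_def using assms that by (intro member_le_sum) auto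
    then have "root 3 (\<bar>x j\<bar> ^ 3) \<le> root 3 S" by simp
    then show ?thesis by (simp add: real_root_power_cancel)
  qed
  then have "(\<Sum>j\<in>J. \<bar>x j\<bar>) \<le> card J * root 3 S"
    using sum_bounded_above[of J "\<lambda>j. \<bar>x j\<bar>" "root 3 S"] by simp
  then have "(\<Sum>j\<in>J. \<bar>x j\<bar>) ^ 3 \<le> (card J * root 3 S) ^ 3"
    by (intro power_mono sum_nonneg) auto
  also have "\<dots> = card J ^ 3 * S" using S0 by (simp add: power_mult_distrib)
  finally show ?thesis by (simp add: S_def)
qed

section \<open>Expectations of log-sum-exp under small centered perturbations\<close>

lemma lse_measurable [measurable]:
  assumes "finite J" and [measurable]: "\<And>j. j \<in> J \<Longrightarrow> X j \<in> borel_measurable M"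
  shows "(\<lambda>\<omega>. lse J (\<lambda>j. X j \<omega>)) \<in> borel_measurable M"
  unfolding lse_def by measurable

lemma (in prob_space) integrable_lse:
  assumes "finite J" "J \<noteq> {}" and X: "\<And>j. j \<in> J \<Longrightarrow> integrable M (X j)"
  shows "integrable M (\<lambda>\<omega>. lse J (\<lambda>j. X j \<omega>))"
proof (rule Bochner_Integration.integrable_bound)
  show "integrable M (\<lambda>\<omega>. (\<Sum>j\<in>J. \<bar>X j \<omega>\<bar>) + ln (card J))"
    using X by (auto intro!: Bochner_Integration.integrable_sum)
  show "(\<lambda>\<omega>. lse J (\<lambda>j. X j \<omega>)) \<in> borel_measurable M"
    using X by (intro lse_measurable assms) auto
  show "AE \<omega> in M. norm (lse J (\<lambda>j. X j \<omega>)) \<le> norm ((\<Sum>j\<in>J. \<bar>X j \<omega>\<bar>) + ln (card J))"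
    using abs_lse_le[OF assms(1,2)] by (auto intro!: AE_I2 order_trans[OF _ abs_ge_self])
qed

text \<open>Averaging the expansion removes the first-order term, the perturbation being centered;
  at order \<open>\<epsilon>\<^sup>2\<close> only second moments of differences are left. The error
  does not depend on the base point \<open>s\<close>.\<close>

lemma (in prob_space) expectation_lse_second_order:
  fixes X :: "'i \<Rightarrow> 'a \<Rightarrow> real"
  assumes J: "finite J" "J \<noteq> {}" and "0 \<le> \<epsilon>"
    and meas [measurable]: "\<And>j. j \<in> J \<Longrightarrow> X j \<in> borel_measurable M"
    and X1: "\<And>j. j \<in> J \<Longrightarrow> integrable M (X j)"
    and X2: "\<And>i j. i \<in> J \<Longrightarrow> j \<in> J \<Longrightarrow> integrable M (\<lambda>\<omega>. (X i \<omega> - X j \<omega>)\<^sup>2)"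
    and X3: "\<And>j. j \<in> J \<Longrightarrow> integrable M (\<lambda>\<omega>. \<bar>X j \<omega>\<bar> ^ 3)"
    and mean: "\<And>j. j \<in> J \<Longrightarrow> expectation (X j) = 0"
  shows "\<bar>expectation (\<lambda>\<omega>. lse J (\<lambda>j. s j + \<epsilon> * X j \<omega>)) - (lse J s
      + \<epsilon>\<^sup>2 * (\<Sum>i\<in>J. \<Sum>j\<in>J. softmax J s i * softmax J s j * expectation (\<lambda>\<omega>. (X i \<omega> - X j \<omega>)\<^sup>2)) / 4)\<bar>
    \<le> \<epsilon> ^ 3 * expectation (\<lambda>\<omega>. (\<Sum>j\<in>J. \<bar>X j \<omega>\<bar>) ^ 3)"
proof -
  have i3: "integrable M (\<lambda>\<omega>. (\<Sum>j\<in>J. \<bar>X j \<omega>\<bar>) ^ 3)"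
  proof (rule Bochner_Integration.integrable_bound)
    show "integrable M (\<lambda>\<omega>. card J ^ 3 * (\<Sum>j\<in>J. \<bar>X j \<omega>\<bar> ^ 3))"
      using X3 by (auto intro!: Bochner_Integration.integrable_sum)
    show "AE \<omega> in M. norm ((\<Sum>j\<in>J. \<bar>X j \<omega>\<bar>) ^ 3) \<le> norm (card J ^ 3 * (\<Sum>j\<in>J. \<bar>X j \<omega>\<bar> ^ 3))"
      using sum_abs_cube_le[OF J(1)]
      by (auto intro!: AE_I2 simp: sum_nonneg abs_mult)
  qed measurable
  define R where "R \<omega> = lse J s + \<epsilon> * (\<Sum>j\<in>J. softmax J s j * X j \<omega>)
      + \<epsilon>\<^sup>2 * (\<Sum>i\<in>J. \<Sum>j\<in>J. softmax J s i * softmax J s j * (X i \<omega> - X j \<omega>)\<^sup>2) / 4" for \<omega>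
  have iR: "integrable M R" unfolding R_def
    using X1 X2 by (auto intro!: Bochner_Integration.integrable_sum)
  have eR: "expectation R = lse J s + \<epsilon>\<^sup>2 * (\<Sum>i\<in>J. \<Sum>j\<in>J. softmax J s i * softmax J s j * expectation (\<lambda>\<omega>. (X i \<omega> - X j \<omega>)\<^sup>2)) / 4"
    unfolding R_def using X1 X2 mean prob_space
    by (simp add: Bochner_Integration.integral_sum Bochner_Integration.integrable_sum)
  have il: "integrable M (\<lambda>\<omega>. lse J (\<lambda>j. s j + \<epsilon> * X j \<omega>))"
    using X1 by (intro integrable_lse J) auto
  have pt: "\<bar>lse J (\<lambda>j. s j + \<epsilon> * X j \<omega>) - R \<omega>\<bar> \<le> \<epsilon> ^ 3 * (\<Sum>j\<in>J. \<bar>X j \<omega>\<bar>) ^ 3" for \<omega>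
  proof -
    have "(\<Sum>j\<in>J. \<bar>\<epsilon> * X j \<omega>\<bar>) ^ 3 = \<epsilon> ^ 3 * (\<Sum>j\<in>J. \<bar>X j \<omega>\<bar>) ^ 3"
      using assms(3) by (simp add: abs_mult power_mult_distrib flip: sum_distrib_left)
    moreover have "(\<epsilon> * X i \<omega> - \<epsilon> * X j \<omega>)\<^sup>2 = \<epsilon>\<^sup>2 * (X i \<omega> - X j \<omega>)\<^sup>2" for i j
      by (simp add: power2_eq_square algebra_simps)
    ultimately show ?thesis
      using lse_second_order[OF J, of s "\<lambda>j. \<epsilon> * X j \<omega>"]
      by (simp add: R_def mult.left_commute[of _ \<epsilon>] mult.left_commute[of _ "\<epsilon>\<^sup>2"] flip: sum_distrib_left)
  qed
  have "\<bar>expectation (\<lambda>\<omega>. lse J (\<lambda>j. s j + \<epsilon> * X j \<omega>)) - expectation R\<bar>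
      = \<bar>expectation (\<lambda>\<omega>. lse J (\<lambda>j. s j + \<epsilon> * X j \<omega>) - R \<omega>)\<bar>"
    using il iR by simp
  also have "\<dots> \<le> expectation (\<lambda>\<omega>. \<bar>lse J (\<lambda>j. s j + \<epsilon> * X j \<omega>) - R \<omega>\<bar>)"
    by (rule integral_abs_bound)
  also have "\<dots> \<le> expectation (\<lambda>\<omega>. \<epsilon> ^ 3 * (\<Sum>j\<in>J. \<bar>X j \<omega>\<bar>) ^ 3)"
    using il iR i3 pt by (intro integral_mono) auto
  finally show ?thesis using eR by simp
qed

section \<open>Lindeberg replacement\<close>

text \<open>A Gaussian vector with covariance \<open>S\<close> is described by its characteristic
  function: independent summands then amount to a product of exponentials, and the joint law can be
  recovered. Integrability is included so that expectations of \<open>lse\<close> exist.\<close>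

definition has_gaussian_char :: "'a measure \<Rightarrow> 'i set \<Rightarrow> ('i \<Rightarrow> 'i \<Rightarrow> real) \<Rightarrow> ('i \<Rightarrow> 'a \<Rightarrow> real) \<Rightarrow> bool" where
  "has_gaussian_char M J S X \<longleftrightarrow> (\<forall>j\<in>J. integrable M (X j)) \<and>
    (\<forall>c. (CLINT \<omega>|M. iexp (\<Sum>j\<in>J. c j * X j \<omega>)) = exp (- (\<Sum>i\<in>J. \<Sum>j\<in>J. c i * c j * S i j) / 2))"

lemma has_gaussian_charD:
  assumes "has_gaussian_char M J S X"
  shows "\<And>j. j \<in> J \<Longrightarrow> integrable M (X j)" "\<And>j. j \<in> J \<Longrightarrow> X j \<in> borel_measurable M"
    "(CLINT \<omega>|M. iexp (\<Sum>j\<in>J. c j * X j \<omega>)) = exp (- (\<Sum>i\<in>J. \<Sum>j\<in>J. c i * c j * S i j) / 2)"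
  using assms unfolding has_gaussian_char_def by auto

lemma expectation_lse_cong:
  assumes "prob_space M" "prob_space N" "finite J"
    and X: "has_gaussian_char M J S X" and Y: "has_gaussian_char N J S' Y"
    and S: "\<And>i j. i \<in> J \<Longrightarrow> j \<in> J \<Longrightarrow> S i j = S' i j"
  shows "(LINT \<omega>|M. lse J (\<lambda>j. X j \<omega>)) = (LINT \<omega>|N. lse J (\<lambda>j. Y j \<omega>))"
proof -
  note [measurable] = has_gaussian_charD(2)[OF X] has_gaussian_charD(2)[OF Y]
  have f: "lse J \<in> borel_measurable (\<Pi>\<^sub>M j\<in>J. borel)"
    using lse_measurable[of J "\<lambda>j x. x j" "\<Pi>\<^sub>M j\<in>J. borel"] assms(3) by simp
  have S2: "(\<Sum>i\<in>J. \<Sum>j\<in>J. c i * c j * S i j) = (\<Sum>i\<in>J. \<Sum>j\<in>J. c i * c j * S' i j)" for c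
    using S by (intro sum.cong) auto
  have law: "distr M (\<Pi>\<^sub>M j\<in>J. borel) (\<lambda>\<omega>. \<lambda>j\<in>J. X j \<omega>) = distr N (\<Pi>\<^sub>M j\<in>J. borel) (\<lambda>\<omega>. \<lambda>j\<in>J. Y j \<omega>)"
    by (rule joint_distribution_unique)
      (use assms in \<open>auto simp only: has_gaussian_charD S2\<close>)
  have "(LINT \<omega>|M. lse J (\<lambda>j. X j \<omega>)) = (LINT \<omega>|M. lse J (\<lambda>j\<in>J. X j \<omega>))"
    by (intro Bochner_Integration.integral_cong refl lse_cong) auto
  also have "\<dots> = (LINT x|distr M (\<Pi>\<^sub>M j\<in>J. borel) (\<lambda>\<omega>. \<lambda>j\<in>J. X j \<omega>). lse J x)"
    using f by (subst integral_distr) (auto intro!: measurable_restrict)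
  also have "\<dots> = (LINT \<omega>|N. lse J (\<lambda>j\<in>J. Y j \<omega>))"
    unfolding law using f by (subst integral_distr) (auto intro!: measurable_restrict)
  also have "\<dots> = (LINT \<omega>|N. lse J (\<lambda>j. Y j \<omega>))"
    by (intro Bochner_Integration.integral_cong refl lse_cong) auto
  finally show ?thesis .
qed

section \<open>Independent combinations on product spaces\<close>

lemma integrable_pair_fst:
  fixes f :: "'a \<Rightarrow> real"
  assumes "prob_space N" "integrable M f"
  shows "integrable (M \<Otimes>\<^sub>M N) (\<lambda>\<omega>. f (fst \<omega>))"
  using assms integrable_distr_eq[of fst "M \<Otimes>\<^sub>M N" M f] prob_space.distr_pair_fst[OF assms(1), of M]
  by auto

lemma integrable_pair_snd:
  fixes f :: "'b \<Rightarrow> real"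
  assumes "prob_space M" "prob_space N" "integrable N f"
  shows "integrable (M \<Otimes>\<^sub>M N) (\<lambda>\<omega>. f (snd \<omega>))"
proof -
  interpret M: prob_space M by fact
  interpret N: prob_space N by fact
  interpret P: pair_prob_space N M ..
  show ?thesis
    using P.integrable_product_swap[OF integrable_pair_fst[OF assms(1,3)]] by (simp add: case_prod_beta')
qed

text \<open>On the product space the two vectors are independent, so Fubini factors the
  characteristic function and the exponents add.\<close>

lemma has_gaussian_char_combine:
  assumes "prob_space M" "prob_space N"
    and X: "has_gaussian_char M J S X" and Y: "has_gaussian_char N J S' Y"
  shows "has_gaussian_char (M \<Otimes>\<^sub>M N) J (\<lambda>i j. a\<^sup>2 * S i j + b\<^sup>2 * S' i j)
    (\<lambda>j \<omega>. a * X j (fst \<omega>) + b * Y j (snd \<omega>))"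
  unfolding has_gaussian_char_def
proof (intro conjI ballI allI)
  interpret M: prob_space M by fact
  interpret N: prob_space N by fact
  interpret P: pair_prob_space M N ..
  note [measurable] = has_gaussian_charD(2)[OF X] has_gaussian_charD(2)[OF Y]
  show "integrable (M \<Otimes>\<^sub>M N) (\<lambda>\<omega>. a * X j (fst \<omega>) + b * Y j (snd \<omega>))" if "j \<in> J" for j
    using that has_gaussian_charD(1)[OF X] has_gaussian_charD(1)[OF Y]
    by (intro Bochner_Integration.integrable_add integrable_mult_right integrable_pair_fst
        integrable_pair_snd assms(1,2)) auto
  fix c
  have split: "iexp (\<Sum>j\<in>J. c j * (a * X j \<omega> + b * Y j \<omega>')) =
    iexp (\<Sum>j\<in>J. (c j * a) * X j \<omega>) * iexp (\<Sum>j\<in>J. (c j * b) * Y j \<omega>')" for \<omega> \<omega>'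
  proof -
    have "(\<Sum>j\<in>J. c j * (a * X j \<omega> + b * Y j \<omega>')) = (\<Sum>j\<in>J. (c j * a) * X j \<omega>) + (\<Sum>j\<in>J. (c j * b) * Y j \<omega>')"
      by (simp add: algebra_simps sum.distrib)
    then show ?thesis by (simp only: mult_exp_exp of_real_add distrib_left)
  qed
  have "(CLINT \<omega>|M \<Otimes>\<^sub>M N. iexp (\<Sum>j\<in>J. c j * (a * X j (fst \<omega>) + b * Y j (snd \<omega>)))) =
    (CLINT \<omega>|M. CLINT \<omega>'|N. iexp (\<Sum>j\<in>J. c j * (a * X j \<omega> + b * Y j \<omega>')))"
    by (subst P.integral_fst'[symmetric]) (auto intro!: P.P.integrable_const_bound[of _ 1])
  also have "\<dots> = (CLINT \<omega>|M. iexp (\<Sum>j\<in>J. (c j * a) * X j \<omega>)) * (CLINT \<omega>|N. iexp (\<Sum>j\<in>J. (c j * b) * Y j \<omega>))"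
    unfolding split by (simp only: integral_mult_right_zero integral_mult_left_zero)
  also have "\<dots> = exp (- (\<Sum>i\<in>J. \<Sum>j\<in>J. c i * a * (c j * a) * S i j) / 2 + - (\<Sum>i\<in>J. \<Sum>j\<in>J. c i * b * (c j * b) * S' i j) / 2)"
    unfolding has_gaussian_charD(3)[OF X] has_gaussian_charD(3)[OF Y] exp_add of_real_mult ..
  also have "- (\<Sum>i\<in>J. \<Sum>j\<in>J. c i * a * (c j * a) * S i j) / 2 + - (\<Sum>i\<in>J. \<Sum>j\<in>J. c i * b * (c j * b) * S' i j) / 2
      = - (\<Sum>i\<in>J. \<Sum>j\<in>J. c i * c j * (a\<^sup>2 * S i j + b\<^sup>2 * S' i j)) / 2"
    by (simp add: power2_eq_square algebra_simps flip: sum.distrib)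
  finally show "(CLINT \<omega>|M \<Otimes>\<^sub>M N. iexp (\<Sum>j\<in>J. c j * (a * X j (fst \<omega>) + b * Y j (snd \<omega>)))) =
    exp (- (\<Sum>i\<in>J. \<Sum>j\<in>J. c i * c j * (a\<^sup>2 * S i j + b\<^sup>2 * S' i j)) / 2)" by simp
qed

text \<open>Lindeberg's replacement scheme: \<open>X\<close> and \<open>Y\<close> have the law of a sum of \<open>m\<close> independent copies of
  \<open>X / sqrt m\<close> and \<open>Y / sqrt m\<close>.  Exchanging one summand changes the expectation of
  \<open>lse\<close> at second order by an average of the increment variances with the nonnegative weights
  \<open>softmax i * softmax j\<close>, and the error terms add up to \<open>O(1 / sqrt m)\<close>.\<close>

lemma expectation_lse_mono:
  assumes "prob_space M" "prob_space N" and J: "finite J" "J \<noteq> {}"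
    and X: "has_gaussian_char M J S X" and Y: "has_gaussian_char N J S' Y"
    and X2: "\<And>i j. i \<in> J \<Longrightarrow> j \<in> J \<Longrightarrow> integrable M (\<lambda>\<omega>. (X i \<omega> - X j \<omega>)\<^sup>2)"
    and Y2: "\<And>i j. i \<in> J \<Longrightarrow> j \<in> J \<Longrightarrow> integrable N (\<lambda>\<omega>. (Y i \<omega> - Y j \<omega>)\<^sup>2)"
    and X3: "\<And>j. j \<in> J \<Longrightarrow> integrable M (\<lambda>\<omega>. \<bar>X j \<omega>\<bar> ^ 3)"
    and Y3: "\<And>j. j \<in> J \<Longrightarrow> integrable N (\<lambda>\<omega>. \<bar>Y j \<omega>\<bar> ^ 3)"
    and mX: "\<And>j. j \<in> J \<Longrightarrow> (LINT \<omega>|M. X j \<omega>) = 0"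
    and mY: "\<And>j. j \<in> J \<Longrightarrow> (LINT \<omega>|N. Y j \<omega>) = 0"
    and XY: "\<And>i j. i \<in> J \<Longrightarrow> j \<in> J \<Longrightarrow> (LINT \<omega>|M. (X i \<omega> - X j \<omega>)\<^sup>2) \<le> (LINT \<omega>|N. (Y i \<omega> - Y j \<omega>)\<^sup>2)"
  shows "(LINT \<omega>|M. lse J (\<lambda>j. X j \<omega>)) \<le> (LINT \<omega>|N. lse J (\<lambda>j. Y j \<omega>))"
proof -
  interpret M: prob_space M by fact
  interpret N: prob_space N by fact
  let ?P = "M \<Otimes>\<^sub>M N"
  interpret P: pair_prob_space M N ..
  interpret PM: pair_prob_space ?P M ..
  interpret PN: pair_prob_space ?P N ..
  note pP = P.prob_space_axioms
  define C where "C = (LINT \<omega>|M. (\<Sum>j\<in>J. \<bar>X j \<omega>\<bar>) ^ 3) + (LINT \<omega>|N. (\<Sum>j\<in>J. \<bar>Y j \<omega>\<bar>) ^ 3)"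
  have step: "(LINT \<omega>|M. lse J (\<lambda>j. s j + \<epsilon> * X j \<omega>)) \<le> (LINT \<omega>|N. lse J (\<lambda>j. s j + \<epsilon> * Y j \<omega>)) + C * \<epsilon> ^ 3"
    if "0 \<le> \<epsilon>" for s \<epsilon>
  proof -
    let ?SX = "\<Sum>i\<in>J. \<Sum>j\<in>J. softmax J s i * softmax J s j * (LINT \<omega>|M. (X i \<omega> - X j \<omega>)\<^sup>2)"
    let ?SY = "\<Sum>i\<in>J. \<Sum>j\<in>J. softmax J s i * softmax J s j * (LINT \<omega>|N. (Y i \<omega> - Y j \<omega>)\<^sup>2)"
    have "?SX \<le> ?SY"
      using XY by (intro sum_mono mult_left_mono) (auto intro!: mult_nonneg_nonneg softmax_nonneg)
    then have "\<epsilon>\<^sup>2 * ?SX \<le> \<epsilon>\<^sup>2 * ?SY" by (intro mult_left_mono) auto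
    moreover have "\<bar>(LINT \<omega>|M. lse J (\<lambda>j. s j + \<epsilon> * X j \<omega>)) - (lse J s + \<epsilon>\<^sup>2 * ?SX / 4)\<bar>
        \<le> \<epsilon> ^ 3 * (LINT \<omega>|M. (\<Sum>j\<in>J. \<bar>X j \<omega>\<bar>) ^ 3)"
      by (rule M.expectation_lse_second_order) (use J that X2 X3 mX has_gaussian_charD[OF X] in auto)
    moreover have "\<bar>(LINT \<omega>|N. lse J (\<lambda>j. s j + \<epsilon> * Y j \<omega>)) - (lse J s + \<epsilon>\<^sup>2 * ?SY / 4)\<bar>
        \<le> \<epsilon> ^ 3 * (LINT \<omega>|N. (\<Sum>j\<in>J. \<bar>Y j \<omega>\<bar>) ^ 3)"
      by (rule N.expectation_lse_second_order) (use J that Y2 Y3 mY has_gaussian_charD[OF Y] in auto)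
    ultimately show ?thesis
      unfolding C_def distrib_right mult.commute[of _ "\<epsilon> ^ 3"] distrib_left by linarith
  qed
  have bound: "(LINT \<omega>|M. lse J (\<lambda>j. X j \<omega>)) \<le> (LINT \<omega>|N. lse J (\<lambda>j. Y j \<omega>)) + C / sqrt m" if m: "0 < m" for m :: nat
  proof -
    \<comment> \<open>A sum of \<open>i\<close> independent copies of \<open>X / sqrt m\<close> and
      \<open>k\<close> of \<open>Y / sqrt m\<close> has the law of
      \<open>Z (sqrt (i / m)) (sqrt (k / m))\<close>. Thus one product space serves for all
      \<open>m\<close>, and only the summand to be exchanged needs a further factor.\<close>
    define Z where "Z a b = (\<lambda>j \<omega>. a * X j (fst \<omega>) + b * Y j (snd \<omega>))" for a b
    define g where "g k = (LINT \<omega>|?P. lse J (\<lambda>j. Z (sqrt ((m - k) / m)) (sqrt (k / m)) j \<omega>))" for k :: nat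
    define \<epsilon> where "\<epsilon> = 1 / sqrt m"
    have \<epsilon>: "0 \<le> \<epsilon>" "\<epsilon>\<^sup>2 = 1 / m" by (auto simp: \<epsilon>_def power_divide)
    note Z = has_gaussian_char_combine[OF assms(1,2) X Y, folded Z_def]
    have gstep: "g k \<le> g (Suc k) + C * \<epsilon> ^ 3" if k: "k < m" for k
    proof -
      \<comment> \<open>\<open>Z a b\<close> stands for the \<open>m - 1\<close> summands common to
        the stages \<open>k\<close> and \<open>Suc k\<close>: \<open>m - Suc k\<close> from
        \<open>X\<close> and \<open>k\<close> from \<open>Y\<close>. The stages differ in the last
        summand, \<open>\<epsilon> * X\<close> against \<open>\<epsilon> * Y\<close>.\<close>
      define a b where "a = sqrt ((m - Suc k) / m)" and "b = sqrt (k / m)"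
      have ab: "a\<^sup>2 = (real m - real k - 1) / m" "b\<^sup>2 = k / m"
        "(sqrt ((m - k) / m))\<^sup>2 = (real m - real k) / m" "(sqrt (Suc k / m))\<^sup>2 = (real k + 1) / m"
        using k by (auto simp: a_def b_def of_nat_diff)
      have iX: "integrable (?P \<Otimes>\<^sub>M M) (\<lambda>\<omega>. lse J (\<lambda>j. Z a b j (fst \<omega>) + \<epsilon> * X j (snd \<omega>)))"
        using has_gaussian_charD(1)[OF Z] has_gaussian_charD(1)[OF X]
        by (intro PM.P.integrable_lse J Bochner_Integration.integrable_add integrable_mult_right
           integrable_pair_fst integrable_pair_snd pP assms(1,2)) auto
      have iY: "integrable (?P \<Otimes>\<^sub>M N) (\<lambda>\<omega>. lse J (\<lambda>j. Z a b j (fst \<omega>) + \<epsilon> * Y j (snd \<omega>)))"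
        using has_gaussian_charD(1)[OF Z] has_gaussian_charD(1)[OF Y]
        by (intro PN.P.integrable_lse J Bochner_Integration.integrable_add integrable_mult_right
           integrable_pair_fst integrable_pair_snd pP assms(1,2)) auto
      have "g k = (LINT \<omega>|(?P \<Otimes>\<^sub>M M). lse J (\<lambda>j. 1 * Z a b j (fst \<omega>) + \<epsilon> * X j (snd \<omega>)))"
        unfolding g_def
        by (rule expectation_lse_cong[OF pP PM.prob_space_axioms J(1) Z has_gaussian_char_combine[OF pP assms(1) Z X]])
          (use m in \<open>simp add: ab \<epsilon> field_simps\<close>)
      also have "\<dots> = (LINT \<omega>|?P. LINT \<omega>'|M. lse J (\<lambda>j. Z a b j \<omega> + \<epsilon> * X j \<omega>'))"
        using PM.integral_fst'[OF iX] by simp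
      \<comment> \<open>For fixed \<open>\<omega>\<close> the common part is the base point
        \<open>s\<close> of \<open>step\<close>. The error is uniform in \<open>s\<close>, so the
        bound can be integrated over \<open>\<omega>\<close>.\<close>
      also have "\<dots> \<le> (LINT \<omega>|?P. (LINT \<omega>'|N. lse J (\<lambda>j. Z a b j \<omega> + \<epsilon> * Y j \<omega>')) + C * \<epsilon> ^ 3)"
        using PM.integrable_fst'[OF iX] PN.integrable_fst'[OF iY] step[OF \<epsilon>(1)]
        by (intro integral_mono) auto
      also have "\<dots> = (LINT \<omega>|?P. (LINT \<omega>'|N. lse J (\<lambda>j. Z a b j \<omega> + \<epsilon> * Y j \<omega>'))) + C * \<epsilon> ^ 3"
        using PN.integrable_fst'[OF iY] P.prob_space by simp
      also have "(LINT \<omega>|?P. (LINT \<omega>'|N. lse J (\<lambda>j. Z a b j \<omega> + \<epsilon> * Y j \<omega>'))) =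
          (LINT \<omega>|(?P \<Otimes>\<^sub>M N). lse J (\<lambda>j. 1 * Z a b j (fst \<omega>) + \<epsilon> * Y j (snd \<omega>)))"
        using PN.integral_fst'[OF iY] by simp
      also have "\<dots> = g (Suc k)"
        unfolding g_def
        by (rule expectation_lse_cong[OF PN.prob_space_axioms pP J(1) has_gaussian_char_combine[OF pP assms(2) Z Y] Z])
          (use m k in \<open>simp add: ab \<epsilon> a_def of_nat_diff field_simps\<close>)
      finally show ?thesis .
    qed
    have "k \<le> m \<Longrightarrow> g 0 \<le> g k + k * (C * \<epsilon> ^ 3)" for k
    proof (induction k)
      case (Suc k)
      then show ?case using gstep[of k] by (simp add: algebra_simps)
    qed simp
    then have "g 0 \<le> g m + m * (C * \<epsilon> ^ 3)" by simp
    moreover have "m * (C * \<epsilon> ^ 3) = C / sqrt m"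
    proof -
      have "m * (C * \<epsilon> ^ 3) = C * \<epsilon> * (m * \<epsilon>\<^sup>2)" by (simp add: power2_eq_square power3_eq_cube)
      then show ?thesis using m \<epsilon>(2) by (simp add: \<epsilon>_def)
    qed
    moreover have "g 0 = (LINT \<omega>|M. lse J (\<lambda>j. X j \<omega>))"
      unfolding g_def using m by (intro expectation_lse_cong[OF pP assms(1) J(1) Z X]) simp
    moreover have "g m = (LINT \<omega>|N. lse J (\<lambda>j. Y j \<omega>))"
      unfolding g_def using m by (intro expectation_lse_cong[OF pP assms(2) J(1) Z Y]) simp
    ultimately show ?thesis by simp
  qed
  have "(\<lambda>m. (LINT \<omega>|N. lse J (\<lambda>j. Y j \<omega>)) + C / sqrt (real m)) \<longlonglongrightarrow> (LINT \<omega>|N. lse J (\<lambda>j. Y j \<omega>)) + 0"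
    by (intro tendsto_add tendsto_const tendsto_divide_0[OF tendsto_const]
        filterlim_at_top_imp_at_infinity filterlim_compose[OF sqrt_at_top] filterlim_real_sequentially)
  then show ?thesis
    using bound by (intro LIMSEQ_le_const[where X = "\<lambda>m. (LINT \<omega>|N. lse J (\<lambda>j. Y j \<omega>)) + C / sqrt (real m)"])
      (auto intro!: exI[of _ 1])
qed

section \<open>The finite Sudakov--Fernique inequality\<close>

lemma centered_gaussian_processD:
  assumes "centered_gaussian_process M I C X"
  shows centered_gaussian_process_prob: "prob_space M"
    and centered_gaussian_process_measurable: "t \<in> I \<Longrightarrow> X t \<in> borel_measurable M"
    and centered_gaussian_process_integrable_abs: "t \<in> I \<Longrightarrow> integrable M (\<lambda>\<omega>. \<bar>X t \<omega>\<bar> ^ k)"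
    and centered_gaussian_process_integrable: "t \<in> I \<Longrightarrow> integrable M (X t)"
    and centered_gaussian_process_integrable_mult:
      "s \<in> I \<Longrightarrow> t \<in> I \<Longrightarrow> integrable M (\<lambda>\<omega>. X s \<omega> * X t \<omega>)"
    and centered_gaussian_process_mean: "t \<in> I \<Longrightarrow> (LINT \<omega>|M. X t \<omega>) = 0"
    and centered_gaussian_process_cov:
      "s \<in> I \<Longrightarrow> t \<in> I \<Longrightarrow> (LINT \<omega>|M. X s \<omega> * X t \<omega>) = C s t"
proof -
  have G: "gaussian_process M I X" using assms by (simp add: centered_gaussian_process_def)
  show P: "prob_space M" using G by (simp add: gaussian_process_def)
  have meas: "X t \<in> borel_measurable M" if "t \<in> I" for t using G that by (simp add: gaussian_process_def)
  have mean: "(LINT \<omega>|M. X t \<omega>) = 0" if "t \<in> I" for t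
    using assms that by (simp add: centered_gaussian_process_def)
  have single: "gaussian_rv M (X t)" if t: "t \<in> I" for t
  proof -
    have "\<forall>J c. finite J \<and> J \<subseteq> I \<longrightarrow> gaussian_rv M (\<lambda>\<omega>. \<Sum>t\<in>J. c t * X t \<omega>)"
      using G by (simp add: gaussian_process_def)
    from this[rule_format, of "{t}" "\<lambda>_. 1"] t show ?thesis by simp
  qed
  have abs: "integrable M (\<lambda>\<omega>. \<bar>X t \<omega>\<bar> ^ k)" if "t \<in> I" for t k
    using centered_gaussian_integrable_abs_moment[OF P single mean] that by auto
  have int: "integrable M (X t)" if "t \<in> I" for t
    using abs[OF that, of 1] meas[OF that] by (simp add: integrable_abs_iff)
  have mult: "integrable M (\<lambda>\<omega>. X s \<omega> * X t \<omega>)" if "s \<in> I" "t \<in> I" for s t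
  proof (rule Bochner_Integration.integrable_bound)
    show "integrable M (\<lambda>\<omega>. \<bar>X s \<omega>\<bar> ^ 2 + \<bar>X t \<omega>\<bar> ^ 2)"
      using abs[OF that(1), of 2] abs[OF that(2), of 2] by simp
    show "(\<lambda>\<omega>. X s \<omega> * X t \<omega>) \<in> borel_measurable M" using meas that by auto
    have "\<bar>x * y\<bar> \<le> x\<^sup>2 + y\<^sup>2" for x y :: real
      using sum_squares_bound[of "\<bar>x\<bar>" "\<bar>y\<bar>"] zero_le_power2[of x] zero_le_power2[of y] abs_ge_zero[of "x * y"]
      by (simp only: abs_mult power2_abs mult.assoc)
    then show "AE \<omega> in M. norm (X s \<omega> * X t \<omega>) \<le> norm (\<bar>X s \<omega>\<bar> ^ 2 + \<bar>X t \<omega>\<bar> ^ 2)"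
      by auto
  qed
  show "t \<in> I \<Longrightarrow> X t \<in> borel_measurable M" "t \<in> I \<Longrightarrow> integrable M (\<lambda>\<omega>. \<bar>X t \<omega>\<bar> ^ k)"
    "t \<in> I \<Longrightarrow> integrable M (X t)" "t \<in> I \<Longrightarrow> (LINT \<omega>|M. X t \<omega>) = 0"
    "s \<in> I \<Longrightarrow> t \<in> I \<Longrightarrow> integrable M (\<lambda>\<omega>. X s \<omega> * X t \<omega>)"
    by (fact meas abs int mean mult)+
  show "(LINT \<omega>|M. X s \<omega> * X t \<omega>) = C s t" if "s \<in> I" "t \<in> I"
    using assms that mean by (simp add: centered_gaussian_process_def covariance_def)
qed

lemma centered_gaussian_process_combination:
  assumes X: "centered_gaussian_process M I C X" and J: "finite J" "J \<subseteq> I"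
  shows "gaussian_rv M (\<lambda>\<omega>. \<Sum>t\<in>J. c t * X t \<omega>)"
    and "(LINT \<omega>|M. (\<Sum>t\<in>J. c t * X t \<omega>)) = 0"
    and "(LINT \<omega>|M. (\<Sum>t\<in>J. c t * X t \<omega>)\<^sup>2) = (\<Sum>s\<in>J. \<Sum>t\<in>J. c s * c t * C s t)"
proof -
  show "gaussian_rv M (\<lambda>\<omega>. \<Sum>t\<in>J. c t * X t \<omega>)"
    using X J by (simp add: centered_gaussian_process_def gaussian_process_def)
  have JI: "t \<in> I" if "t \<in> J" for t using that J by auto
  show "(LINT \<omega>|M. (\<Sum>t\<in>J. c t * X t \<omega>)) = 0"
    using centered_gaussian_process_integrable[OF X JI] centered_gaussian_process_mean[OF X JI]
    by (simp add: Bochner_Integration.integral_sum)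
  have "(LINT \<omega>|M. (\<Sum>t\<in>J. c t * X t \<omega>)\<^sup>2) = (LINT \<omega>|M. (\<Sum>s\<in>J. \<Sum>t\<in>J. c s * c t * (X s \<omega> * X t \<omega>)))"
    by (simp add: power2_eq_square sum_product algebra_simps)
  also have "\<dots> = (\<Sum>s\<in>J. \<Sum>t\<in>J. c s * c t * C s t)"
    using centered_gaussian_process_integrable_mult[OF X JI JI] centered_gaussian_process_cov[OF X JI JI]
    by (simp add: Bochner_Integration.integral_sum Bochner_Integration.integrable_sum)
  finally show "(LINT \<omega>|M. (\<Sum>t\<in>J. c t * X t \<omega>)\<^sup>2) = (\<Sum>s\<in>J. \<Sum>t\<in>J. c s * c t * C s t)" .
qed

lemma centered_gaussian_process_char:
  assumes X: "centered_gaussian_process M I C X" and J: "finite J" "J \<subseteq> I"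
  shows "has_gaussian_char M J (\<lambda>s t. \<beta>\<^sup>2 * C s t) (\<lambda>t \<omega>. \<beta> * X t \<omega>)"
  unfolding has_gaussian_char_def
proof (intro conjI ballI allI)
  show "integrable M (\<lambda>\<omega>. \<beta> * X t \<omega>)" if "t \<in> J" for t
    using centered_gaussian_process_integrable[OF X] that J by auto
  fix c
  note comb = centered_gaussian_process_combination[OF X J, of "\<lambda>t. c t * \<beta>"]
  have "(\<Sum>s\<in>J. \<Sum>t\<in>J. c s * \<beta> * (c t * \<beta>) * C s t) = (\<Sum>s\<in>J. \<Sum>t\<in>J. c s * c t * (\<beta>\<^sup>2 * C s t))"
    by (simp add: power2_eq_square algebra_simps)
  then show "(CLINT \<omega>|M. iexp (\<Sum>t\<in>J. c t * (\<beta> * X t \<omega>))) = exp (- (\<Sum>s\<in>J. \<Sum>t\<in>J. c s * c t * (\<beta>\<^sup>2 * C s t)) / 2)"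
    using centered_gaussian_char[OF centered_gaussian_process_prob[OF X] comb(1,2)] unfolding comb(3)
    by (simp only: mult.assoc)
qed

lemma increment_moments:
  assumes X: "centered_gaussian_process M I C X" and st: "s \<in> I" "t \<in> I"
  shows increment_abs_moment: "(LINT \<omega>|M. \<bar>X s \<omega> - X t \<omega>\<bar> ^ k) = abs_normal_moment k * sqrt (increment_var C s t) ^ k"
    and increment_integrable: "integrable M (\<lambda>\<omega>. \<bar>X s \<omega> - X t \<omega>\<bar> ^ k)"
    and increment_second_moment: "(LINT \<omega>|M. (X s \<omega> - X t \<omega>)\<^sup>2) = increment_var C s t"
proof -
  let ?c = "\<lambda>r. if r = s then 1 else (-1 :: real)"
  have eq: "gaussian_rv M (\<lambda>\<omega>. X s \<omega> - X t \<omega>) \<and> (LINT \<omega>|M. (X s \<omega> - X t \<omega>)) = 0 \<and>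
    (LINT \<omega>|M. (X s \<omega> - X t \<omega>)\<^sup>2) = increment_var C s t"
  \<comment> \<open>For \<open>s = t\<close> the set \<open>{s, t}\<close> is a singleton, and
    \<open>?c\<close> would produce \<open>X s\<close> instead of the difference.\<close>
  proof (cases "s = t")
    case True
    have "gaussian_rv M (\<lambda>\<omega>. 0)" by (auto simp: gaussian_rv_def)
    then show ?thesis using True by (simp add: increment_var_def)
  next
    case False
    then show ?thesis
      using centered_gaussian_process_combination[OF X, of "{s, t}" ?c] st
      by (simp add: increment_var_def)
  qed
  then show "(LINT \<omega>|M. (X s \<omega> - X t \<omega>)\<^sup>2) = increment_var C s t" by simp
  show "(LINT \<omega>|M. \<bar>X s \<omega> - X t \<omega>\<bar> ^ k) = abs_normal_moment k * sqrt (increment_var C s t) ^ k"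
    "integrable M (\<lambda>\<omega>. \<bar>X s \<omega> - X t \<omega>\<bar> ^ k)"
    using centered_gaussian_abs_moment[OF centered_gaussian_process_prob[OF X], of "\<lambda>\<omega>. X s \<omega> - X t \<omega>" k]
      centered_gaussian_integrable_abs_moment[OF centered_gaussian_process_prob[OF X], of "\<lambda>\<omega>. X s \<omega> - X t \<omega>" k] eq
    by auto
qed

lemma integrable_Max:
  fixes X :: "'i \<Rightarrow> 'a \<Rightarrow> real"
  assumes "finite J" "J \<noteq> {}" and X: "\<And>j. j \<in> J \<Longrightarrow> integrable M (X j)"
  shows "integrable M (\<lambda>\<omega>. Max ((\<lambda>j. X j \<omega>) ` J))"
proof (rule Bochner_Integration.integrable_bound)
  show "integrable M (\<lambda>\<omega>. \<Sum>j\<in>J. \<bar>X j \<omega>\<bar>)" using X by auto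
  show "(\<lambda>\<omega>. Max ((\<lambda>j. X j \<omega>) ` J)) \<in> borel_measurable M"
    using assms by (intro borel_measurable_Max) auto
  show "AE \<omega> in M. norm (Max ((\<lambda>j. X j \<omega>) ` J)) \<le> norm (\<Sum>j\<in>J. \<bar>X j \<omega>\<bar>)"
  proof (intro AE_I2)
    fix \<omega>
    have "Max ((\<lambda>j. X j \<omega>) ` J) \<in> (\<lambda>j. X j \<omega>) ` J" using assms by (intro Max_in) auto
    then obtain j where j: "j \<in> J" "Max ((\<lambda>j. X j \<omega>) ` J) = X j \<omega>" by auto
    have "\<bar>X j \<omega>\<bar> \<le> (\<Sum>j\<in>J. \<bar>X j \<omega>\<bar>)" using j assms by (intro member_le_sum) auto
    then show "norm (Max ((\<lambda>j. X j \<omega>) ` J)) \<le> norm (\<Sum>j\<in>J. \<bar>X j \<omega>\<bar>)" using j by simp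
  qed
qed

text \<open>Scaling both processes by \<open>\<beta>\<close> keeps the order of the increments,
  while \<open>lse\<close> of the scaled values divided by \<open>\<beta>\<close> exceeds the
  maximum by at most \<open>ln (card J) / \<beta>\<close>; this error disappears as
  \<open>\<beta>\<close> grows.\<close>

theorem sudakov_fernique_finite:
  assumes X: "centered_gaussian_process M I C X" and Y: "centered_gaussian_process N I D Y"
    and J: "finite J" "J \<subseteq> I" "J \<noteq> {}"
    and incr: "\<And>s t. s \<in> J \<Longrightarrow> t \<in> J \<Longrightarrow> increment_var C s t \<le> increment_var D s t"
  shows "(LINT \<omega>|M. Max ((\<lambda>t. X t \<omega>) ` J)) \<le> (LINT \<omega>|N. Max ((\<lambda>t. Y t \<omega>) ` J))"
proof -
  interpret M: prob_space M using X by (rule centered_gaussian_process_prob)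
  interpret N: prob_space N using Y by (rule centered_gaussian_process_prob)
  have JI: "t \<in> I" if "t \<in> J" for t using that J by auto
  note iX = centered_gaussian_process_integrable[OF X JI] and iY = centered_gaussian_process_integrable[OF Y JI]
  have scale: "(\<beta> * x - \<beta> * y)\<^sup>2 = \<beta>\<^sup>2 * \<bar>x - y\<bar>\<^sup>2" for \<beta> x y :: real
    by (simp add: power2_eq_square algebra_simps)
  have bound: "(LINT \<omega>|M. Max ((\<lambda>t. X t \<omega>) ` J)) \<le> (LINT \<omega>|N. Max ((\<lambda>t. Y t \<omega>) ` J)) + ln (card J) / \<beta>"
    if \<beta>: "0 < \<beta>" for \<beta> :: real
  proof -
    have lX: "integrable M (\<lambda>\<omega>. lse J (\<lambda>t. \<beta> * X t \<omega>))" using iX J by (intro M.integrable_lse) auto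
    have lY: "integrable N (\<lambda>\<omega>. lse J (\<lambda>t. \<beta> * Y t \<omega>))" using iY J by (intro N.integrable_lse) auto
    have mX: "integrable M (\<lambda>\<omega>. Max ((\<lambda>t. X t \<omega>) ` J))" using iX J by (intro integrable_Max)
    have mY: "integrable N (\<lambda>\<omega>. Max ((\<lambda>t. Y t \<omega>) ` J))" using iY J by (intro integrable_Max)
    have lower: "\<beta> * Max ((\<lambda>t. X t \<omega>) ` J) \<le> lse J (\<lambda>t. \<beta> * X t \<omega>)" for \<omega>
    proof -
      have "Max ((\<lambda>j. X j \<omega>) ` J) \<in> (\<lambda>j. X j \<omega>) ` J" using J by (intro Max_in) auto
      then obtain j where "j \<in> J" "Max ((\<lambda>j. X j \<omega>) ` J) = X j \<omega>" by auto
      then show ?thesis using lse_ge[OF J(1), of j "\<lambda>t. \<beta> * X t \<omega>"] by simp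
    qed
    have upper: "lse J (\<lambda>t. \<beta> * Y t \<omega>) \<le> \<beta> * Max ((\<lambda>t. Y t \<omega>) ` J) + ln (card J)" for \<omega>
      using J \<beta> by (intro lse_le mult_left_mono Max_ge) auto
    have "\<beta> * (LINT \<omega>|M. Max ((\<lambda>t. X t \<omega>) ` J)) = (LINT \<omega>|M. \<beta> * Max ((\<lambda>t. X t \<omega>) ` J))" by simp
    also have "\<dots> \<le> (LINT \<omega>|M. lse J (\<lambda>t. \<beta> * X t \<omega>))"
      using lX mX lower by (intro integral_mono) auto
    also have "\<dots> \<le> (LINT \<omega>|N. lse J (\<lambda>t. \<beta> * Y t \<omega>))"
    proof (rule expectation_lse_mono[OF M.prob_space_axioms N.prob_space_axioms J(1,3)
          centered_gaussian_process_char[OF X J(1,2)] centered_gaussian_process_char[OF Y J(1,2)]])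
      fix s t assume st: "s \<in> J" "t \<in> J"
      show "integrable M (\<lambda>\<omega>. (\<beta> * X s \<omega> - \<beta> * X t \<omega>)\<^sup>2)" "integrable N (\<lambda>\<omega>. (\<beta> * Y s \<omega> - \<beta> * Y t \<omega>)\<^sup>2)"
        unfolding scale using increment_integrable[OF X JI JI, of s t 2] increment_integrable[OF Y JI JI, of s t 2] st by auto
      show "(LINT \<omega>|M. (\<beta> * X s \<omega> - \<beta> * X t \<omega>)\<^sup>2) \<le> (LINT \<omega>|N. (\<beta> * Y s \<omega> - \<beta> * Y t \<omega>)\<^sup>2)"
        unfolding scale using increment_second_moment[OF X JI JI, of s t] increment_second_moment[OF Y JI JI, of s t] st incr[OF st]
        by (auto intro!: mult_left_mono)
    next
      fix t assume t: "t \<in> J"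
      show "integrable M (\<lambda>\<omega>. \<bar>\<beta> * X t \<omega>\<bar> ^ 3)" "integrable N (\<lambda>\<omega>. \<bar>\<beta> * Y t \<omega>\<bar> ^ 3)"
        unfolding abs_mult power_mult_distrib
        using centered_gaussian_process_integrable_abs[OF X JI[OF t]] centered_gaussian_process_integrable_abs[OF Y JI[OF t]] by auto
      show "(LINT \<omega>|M. \<beta> * X t \<omega>) = 0" "(LINT \<omega>|N. \<beta> * Y t \<omega>) = 0"
        using centered_gaussian_process_mean[OF X JI[OF t]] centered_gaussian_process_mean[OF Y JI[OF t]] by auto
    qed
    also have "\<dots> \<le> (LINT \<omega>|N. \<beta> * Max ((\<lambda>t. Y t \<omega>) ` J) + ln (card J))"
      using lY mY upper by (intro integral_mono) auto
    also have "\<dots> = \<beta> * (LINT \<omega>|N. Max ((\<lambda>t. Y t \<omega>) ` J)) + ln (card J)"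
      using mY N.prob_space by simp
    finally show ?thesis using \<beta> by (simp add: field_simps)
  qed
  have "(\<lambda>n. (LINT \<omega>|N. Max ((\<lambda>t. Y t \<omega>) ` J)) + ln (card J) / real n) \<longlonglongrightarrow> (LINT \<omega>|N. Max ((\<lambda>t. Y t \<omega>) ` J)) + 0"
    by (intro tendsto_add tendsto_const lim_const_over_n)
  then show ?thesis
    using bound by (intro LIMSEQ_le_const[where X = "\<lambda>n. (LINT \<omega>|N. Max ((\<lambda>t. Y t \<omega>) ` J)) + ln (card J) / real n"])
      (auto intro!: exI[of _ 1])
qed

section \<open>Suprema of paths\<close>

definition dyadic_grid :: "real \<Rightarrow> nat \<Rightarrow> real set" where
  "dyadic_grid T n = (\<lambda>k. T * real k / 2 ^ n) ` {..2 ^ n}"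

lemma dyadic_grid_basics:
  shows finite_dyadic_grid: "finite (dyadic_grid T n)"
    and dyadic_grid_nonempty: "dyadic_grid T n \<noteq> {}"
    and dyadic_grid_subset: "0 \<le> T \<Longrightarrow> dyadic_grid T n \<subseteq> {0..T}"
    and dyadic_grid_Suc: "dyadic_grid T n \<subseteq> dyadic_grid T (Suc n)"
proof -
  show "finite (dyadic_grid T n)" "dyadic_grid T n \<noteq> {}" by (auto simp: dyadic_grid_def)
  show "dyadic_grid T n \<subseteq> {0..T}" if "0 \<le> T"
  proof
    fix t assume "t \<in> dyadic_grid T n"
    then obtain k where k: "k \<le> 2 ^ n" "t = T * real k / 2 ^ n" by (auto simp: dyadic_grid_def)
    have "real k \<le> 2 ^ n" using k(1) by (simp add: of_nat_le_iff flip: of_nat_power)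
    then have "T * real k \<le> T * 2 ^ n" using that by (intro mult_left_mono)
    then show "t \<in> {0..T}" using that by (auto simp: k(2) field_simps)
  qed
  show "dyadic_grid T n \<subseteq> dyadic_grid T (Suc n)"
  proof
    fix t assume "t \<in> dyadic_grid T n"
    then obtain k where k: "k \<le> 2 ^ n" "t = T * real k / 2 ^ n" by (auto simp: dyadic_grid_def)
    then show "t \<in> dyadic_grid T (Suc n)"
      unfolding dyadic_grid_def by (intro image_eqI[of _ _ "2 * k"]) auto
  qed
qed

lemma Max_dyadic_grid_tendsto_SUP:
  fixes f :: "real \<Rightarrow> real"
  assumes T: "0 < T" and f: "continuous_on {0..T} f"
  shows "(\<lambda>n. Max (f ` dyadic_grid T n)) \<longlonglongrightarrow> (SUP t\<in>{0..T}. f t)"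
proof -
  obtain u where u: "u \<in> {0..T}" "\<And>t. t \<in> {0..T} \<Longrightarrow> f t \<le> f u"
    using continuous_attains_sup[OF _ _ f] T by auto
  have sup: "(SUP t\<in>{0..T}. f t) = f u"
    using u by (intro cSup_eq_maximum) auto
  show ?thesis
  proof (rule LIMSEQ_I)
    fix e :: real assume "0 < e"
    then obtain d where d: "0 < d" "\<And>t. t \<in> {0..T} \<Longrightarrow> dist t u < d \<Longrightarrow> dist (f t) (f u) < e"
      using f u(1) unfolding continuous_on_iff by blast
    have "(\<lambda>n. T * (1 / 2) ^ n) \<longlonglongrightarrow> T * 0"
      by (intro tendsto_mult tendsto_const LIMSEQ_power_zero) auto
    then have "\<forall>\<^sub>F n in sequentially. T * (1 / 2) ^ n < d"
      using d(1) by (intro order_tendstoD(2)[of _ "T * 0"]) auto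
    then obtain n0 where n0: "\<And>n. n0 \<le> n \<Longrightarrow> T * (1 / 2) ^ n < d"
      by (auto simp: eventually_sequentially)
    show "\<exists>n0. \<forall>n\<ge>n0. norm (Max (f ` dyadic_grid T n) - (SUP t\<in>{0..T}. f t)) < e"
    proof (intro exI allI impI)
      fix n assume n: "n0 \<le> n"
      \<comment> \<open>This selects the last grid point \<open>t\<close> not beyond the maximiser
        \<open>u\<close>. Approaching from the left keeps \<open>t\<close> in the interval;
        \<open>u = T\<close> gives \<open>k = 2 ^ n\<close>, the right end of the grid.\<close>
      define k where "k = nat \<lfloor>u * 2 ^ n / T\<rfloor>"
      define t where "t = T * real k / 2 ^ n"
      have "0 \<le> u * 2 ^ n / T" using u T by auto
      then have rk: "real k = of_int \<lfloor>u * 2 ^ n / T\<rfloor>" by (simp add: k_def)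
      have k1: "real k \<le> u * 2 ^ n / T" and k2: "u * 2 ^ n / T < real k + 1"
        unfolding rk by linarith+
      have "u * 2 ^ n / T \<le> 2 ^ n" using u T by (simp add: field_simps)
      then have "real k \<le> 2 ^ n" using k1 by linarith
      then have "k \<le> 2 ^ n" by (simp add: of_nat_le_iff flip: of_nat_power)
      then have t: "t \<in> dyadic_grid T n" by (auto simp: t_def dyadic_grid_def)
      then have tI: "t \<in> {0..T}" using dyadic_grid_subset[of T n] T by auto
      have "t \<le> u" "u < t + T * (1 / 2) ^ n"
        using k1 k2 T by (auto simp: t_def field_simps power_divide)
      then have "dist t u < d" using n0[OF n] by (simp add: dist_real_def)
      then have "f u - e < f t" using d(2)[OF tI] by (simp add: dist_real_def)
      moreover have "f t \<le> Max (f ` dyadic_grid T n)"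
        using t finite_dyadic_grid by (intro Max_ge) auto
      moreover have "Max (f ` dyadic_grid T n) \<le> f u"
        using u(2) dyadic_grid_subset[of T n] T finite_dyadic_grid dyadic_grid_nonempty
        by (intro Max.boundedI) auto
      ultimately show "norm (Max (f ` dyadic_grid T n) - (SUP t\<in>{0..T}. f t)) < e"
        unfolding sup by simp
    qed
  qed
qed

section \<open>Chaining along dyadic grids\<close>

lemma le_add_power_div:
  fixes x \<delta> :: real
  assumes "0 < \<delta>" "0 \<le> x"
  shows "x \<le> \<delta> + x ^ Suc p / \<delta> ^ p"
proof (cases "x \<le> \<delta>")
  case True
  then show ?thesis using assms by (simp add: add_increasing2)
next
  case False
  then have "\<delta> ^ p \<le> x ^ p" using assms by (intro power_mono) auto
  then have "x * \<delta> ^ p \<le> x * x ^ p" using assms by (intro mult_left_mono) auto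
  then have "x \<le> x ^ Suc p / \<delta> ^ p" using assms by (simp add: field_simps)
  then show ?thesis using assms by linarith
qed

text \<open>A new grid point has odd index, and its left neighbour lies on the old grid. The
  increment between them is at most \<open>\<delta>\<close>, or else at most its power
  \<open>Suc p\<close> divided by \<open>\<delta> ^ p\<close>. Bounding that power by the sum over
  all increments replaces a maximum by a sum, whose expectation is a sum of moments.\<close>

lemma Max_dyadic_grid_Suc_le:
  fixes f :: "real \<Rightarrow> real"
  assumes "0 < \<delta>"
  shows "Max (f ` dyadic_grid T (Suc n)) \<le> Max (f ` dyadic_grid T n)
    + (\<delta> + (\<Sum>k<2 ^ Suc n. \<bar>f (T * real k / 2 ^ Suc n) - f (T * real (Suc k) / 2 ^ Suc n)\<bar> ^ Suc p) / \<delta> ^ p)"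
    (is "_ \<le> ?A + (\<delta> + ?S / _)")
proof (rule Max.boundedI)
  have S0: "0 \<le> ?S" by (intro sum_nonneg) auto
  fix y assume "y \<in> f ` dyadic_grid T (Suc n)"
  then obtain k where k: "k \<le> 2 ^ Suc n" "y = f (T * real k / 2 ^ Suc n)"
    by (auto simp: dyadic_grid_def)
  have grid: "f (T * real (2 * j) / 2 ^ Suc n) \<le> ?A" if "2 * j \<le> 2 ^ Suc n" for j
    using that by (intro Max_ge finite_imageI finite_dyadic_grid) (auto simp: dyadic_grid_def intro!: imageI)
  show "y \<le> ?A + (\<delta> + ?S / \<delta> ^ p)"
  proof (cases "even k")
    case True
    then obtain j where "k = 2 * j" by (elim evenE)
    then have "y \<le> ?A" using grid k by auto
    then show ?thesis using S0 assms by (simp add: add_increasing2)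
  next
    case False
    then obtain j where j: "k = Suc (2 * j)" by (elim oddE) auto
    let ?\<Delta> = "\<bar>f (T * real (2 * j) / 2 ^ Suc n) - f (T * real (Suc (2 * j)) / 2 ^ Suc n)\<bar>"
    have "?\<Delta> \<le> \<delta> + ?\<Delta> ^ Suc p / \<delta> ^ p" using assms by (intro le_add_power_div) auto
    also have "?\<Delta> ^ Suc p \<le> ?S"
      using k j by (intro member_le_sum[of "2 * j" _ "\<lambda>k. \<bar>f (T * real k / 2 ^ Suc n) - f (T * real (Suc k) / 2 ^ Suc n)\<bar> ^ Suc p"]) auto
    finally have "?\<Delta> \<le> \<delta> + ?S / \<delta> ^ p" using assms by (simp add: divide_right_mono)
    moreover have "f (T * real (2 * j) / 2 ^ Suc n) \<le> ?A" using grid k j by auto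
    ultimately show ?thesis unfolding k(2) j by linarith
  qed
qed (auto simp: finite_dyadic_grid dyadic_grid_nonempty)

text \<open>The cost of level \<open>m\<close>: there are \<open>2 ^ m\<close> increments, each with
  standard deviation of order \<open>a ^ m * a ^ m\<close>, truncated at \<open>a ^ m\<close>. After
  cancellation \<open>a ^ (m * p)\<close> is left next to harmless factors, and
  \<open>a ^ p \<le> 1 / 4\<close> beats the number of increments.\<close>

lemma chaining_rate:
  fixes a \<gamma> :: real
  assumes "0 < a" "a < 1" "0 \<le> \<gamma>" "a ^ p \<le> 1 / 4"
  shows "2 ^ m * (\<gamma> * (a ^ m * a ^ m) ^ Suc p) / (a ^ m) ^ p \<le> \<gamma> * (1 / 2) ^ m"
proof -
  define b where "b = a ^ m"
  have b: "0 < b" "b \<le> 1" using assms by (auto simp: b_def power_le_one)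
  have "b ^ p = (a ^ p) ^ m" by (simp add: b_def mult.commute flip: power_mult)
  also have "\<dots> \<le> (1 / 4) ^ m" using assms by (intro power_mono) auto
  finally have bp: "b ^ p \<le> (1 / 4) ^ m" .
  have "2 ^ m * (\<gamma> * (b * b) ^ Suc p) / b ^ p = 2 ^ m * (\<gamma> * (b ^ p * (b * b)))"
    using b by (simp add: power_mult_distrib)
  also have "\<dots> \<le> 2 ^ m * (\<gamma> * ((1 / 4) ^ m * 1))"
    using b bp assms by (intro mult_left_mono mult_mono mult_le_one) auto
  also have "\<dots> = \<gamma> * (2 ^ m * (1 / 4) ^ m)" by (simp only: mult_ac mult_1_right mult_1)
  also have "(2 :: real) ^ m * (1 / 4) ^ m = (1 / 2) ^ m" by (simp flip: power_mult_distrib)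
  finally show ?thesis by (simp add: b_def)
qed

lemma expectation_Max_dyadic_grid_bounded:
  assumes X: "centered_gaussian_process M {0..T} C X" and T: "0 < T" and h: "0 < h"
    and incr: "\<And>s t. s \<in> {0..T} \<Longrightarrow> t \<in> {0..T} \<Longrightarrow> increment_var C s t \<le> c * \<bar>s - t\<bar> powr (2 * h)"
  obtains b where "\<And>n. (LINT \<omega>|M. Max ((\<lambda>t. X t \<omega>) ` dyadic_grid T n)) \<le> b"
proof -
  interpret prob_space M using X by (rule centered_gaussian_process_prob)
  \<comment> \<open>Since \<open>a\<^sup>2 = 2 powr (- h)\<close>, increments at level
    \<open>n\<close> have standard deviation at most \<open>\<kappa> * (a ^ n * a ^ n)\<close>. The
    threshold \<open>a ^ n\<close> is larger by the factor \<open>a ^ n\<close> in the denominator,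
    up to \<open>\<kappa>\<close>, and still summable over the levels; a large \<open>p\<close>
    exploits this margin.\<close>
  define a :: real where "a = 2 powr (- h / 2)"
  have a: "0 < a" "a < 1" using h by (auto simp: a_def powr_less_one)
  define c' where "c' = max c 0"
  define \<kappa> where "\<kappa> = sqrt c' * T powr h"
  have \<kappa>0: "0 \<le> \<kappa>" by (simp add: \<kappa>_def c'_def)
  obtain p where p: "a ^ p < 1 / 4" using real_arch_pow_inv[of "1/4" a] a by auto
  define \<gamma> where "\<gamma> = abs_normal_moment (Suc p) * \<kappa> ^ Suc p"
  have \<gamma>0: "0 \<le> \<gamma>" using abs_normal_moment_nonneg \<kappa>0 by (auto simp: \<gamma>_def)
  define A where "A n \<omega> = Max ((\<lambda>t. X t \<omega>) ` dyadic_grid T n)" for n \<omega>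
  have gI: "t \<in> {0..T}" if "t \<in> dyadic_grid T n" for t n
    using that dyadic_grid_subset[of T n] T by auto
  have pt: "T * real k / 2 ^ n \<in> {0..T}" if "k \<le> 2 ^ n" for k n
    using that gI[of _ n] by (auto simp: dyadic_grid_def)
  have iA: "integrable M (A n)" for n
    unfolding A_def using centered_gaussian_process_integrable[OF X gI]
    by (intro integrable_Max finite_dyadic_grid dyadic_grid_nonempty)
  have apow: "a ^ n * a ^ n = 2 powr (- h * n)" for n
    by (simp add: a_def powr_power flip: powr_add)
  have sd: "sqrt (increment_var C (T * real k / 2 ^ n) (T * real (Suc k) / 2 ^ n)) \<le> \<kappa> * (a ^ n * a ^ n)"
    if "k < 2 ^ n" for k n
  proof -
    have "increment_var C (T * real k / 2 ^ n) (T * real (Suc k) / 2 ^ n)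
      \<le> c * \<bar>T * real k / 2 ^ n - T * real (Suc k) / 2 ^ n\<bar> powr (2 * h)"
      using that by (intro incr pt) auto
    also have "\<bar>T * real k / 2 ^ n - T * real (Suc k) / 2 ^ n\<bar> = T / 2 ^ n"
      using T by (simp add: field_simps)
    also have "c * (T / 2 ^ n) powr (2 * h) \<le> c' * (T / 2 ^ n) powr (2 * h)"
      unfolding c'_def by (intro mult_right_mono) auto
    also have "(T / 2 ^ n) powr (2 * h) = ((T / 2 ^ n) powr h)\<^sup>2"
      by (simp add: power2_eq_square flip: powr_add)
    finally have "sqrt (increment_var C (T * real k / 2 ^ n) (T * real (Suc k) / 2 ^ n)) \<le> sqrt (c' * ((T / 2 ^ n) powr h)\<^sup>2)"
      by simp
    also have "\<dots> = sqrt c' * (T / 2 ^ n) powr h" by (simp add: real_sqrt_mult)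
    also have "(T / 2 ^ n) powr h = T powr h * (a ^ n * a ^ n)"
      unfolding apow using T
      by (simp add: powr_divide powr_powr powr_minus field_simps flip: powr_realpow)
    finally show ?thesis by (simp add: \<kappa>_def)
  qed
  have step: "expectation (A (Suc n)) \<le> expectation (A n) + (a ^ Suc n + \<gamma> * (1 / 2) ^ Suc n)" for n
  proof -
    let ?m = "Suc n"
    define \<Delta> where "\<Delta> k \<omega> = \<bar>X (T * real k / 2 ^ ?m) \<omega> - X (T * real (Suc k) / 2 ^ ?m) \<omega>\<bar> ^ Suc p" for k \<omega>
    have i\<Delta>: "integrable M (\<Delta> k)" if "k < 2 ^ ?m" for k
      unfolding \<Delta>_def using that by (intro increment_integrable[OF X] pt) auto
    have e\<Delta>: "expectation (\<Delta> k) \<le> \<gamma> * (a ^ ?m * a ^ ?m) ^ Suc p" if "k < 2 ^ ?m" for k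
    proof -
      have "expectation (\<Delta> k) = abs_normal_moment (Suc p)
        * sqrt (increment_var C (T * real k / 2 ^ ?m) (T * real (Suc k) / 2 ^ ?m)) ^ Suc p"
        unfolding \<Delta>_def using that by (intro increment_abs_moment[OF X] pt) auto
      also have "\<dots> \<le> abs_normal_moment (Suc p) * (\<kappa> * (a ^ ?m * a ^ ?m)) ^ Suc p"
      proof (intro mult_left_mono power_mono sd that abs_normal_moment_nonneg)
        \<comment> \<open>\<open>C\<close> is given as a mere function; the sign comes from the
          increment variance being a second moment.\<close>
        have "0 \<le> increment_var C (T * real k / 2 ^ ?m) (T * real (Suc k) / 2 ^ ?m)"
          using that by (subst increment_second_moment[OF X pt pt, symmetric]) auto
        then show "0 \<le> sqrt (increment_var C (T * real k / 2 ^ ?m) (T * real (Suc k) / 2 ^ ?m))" by simp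
      qed
      finally show ?thesis by (simp only: \<gamma>_def power_mult_distrib mult.assoc)
    qed
    have pw: "A ?m \<omega> \<le> A n \<omega> + (a ^ ?m + (\<Sum>k<2 ^ ?m. \<Delta> k \<omega>) / (a ^ ?m) ^ p)" for \<omega>
      unfolding A_def \<Delta>_def using a by (intro Max_dyadic_grid_Suc_le) (simp del: power_Suc)
    have iR: "integrable M (\<lambda>\<omega>. A n \<omega> + (a ^ ?m + (\<Sum>k<2 ^ ?m. \<Delta> k \<omega>) / (a ^ ?m) ^ p))"
      by (intro Bochner_Integration.integrable_add integrable_const integrable_divide
          Bochner_Integration.integrable_sum iA) (use i\<Delta> in auto)
    have "expectation (A ?m) \<le> expectation (\<lambda>\<omega>. A n \<omega> + (a ^ ?m + (\<Sum>k<2 ^ ?m. \<Delta> k \<omega>) / (a ^ ?m) ^ p))"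
      by (intro integral_mono iA iR pw)
    also have "\<dots> = expectation (A n) + (a ^ ?m + (\<Sum>k<2 ^ ?m. expectation (\<Delta> k)) / (a ^ ?m) ^ p)"
    proof -
      have "integrable M (\<lambda>\<omega>. \<Sum>k<2 ^ ?m. \<Delta> k \<omega>)" using i\<Delta> by (intro Bochner_Integration.integrable_sum) auto
      moreover have "expectation (\<lambda>\<omega>. \<Sum>k<2 ^ ?m. \<Delta> k \<omega>) = (\<Sum>k<2 ^ ?m. expectation (\<Delta> k))"
        using i\<Delta> by (intro Bochner_Integration.integral_sum) auto
      ultimately show ?thesis using iA prob_space by (simp del: power_Suc sum.lessThan_Suc)
    qed
    also have "(\<Sum>k<2 ^ ?m. expectation (\<Delta> k)) / (a ^ ?m) ^ p \<le> \<gamma> * (1 / 2) ^ ?m"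
    proof -
      have "(\<Sum>k<2 ^ ?m. expectation (\<Delta> k)) \<le> (\<Sum>k<(2::nat) ^ ?m. \<gamma> * (a ^ ?m * a ^ ?m) ^ Suc p)"
        using e\<Delta> by (intro sum_mono) auto
      also have "\<dots> = 2 ^ ?m * (\<gamma> * (a ^ ?m * a ^ ?m) ^ Suc p)"
        by (simp del: power_Suc)
      finally have "(\<Sum>k<2 ^ ?m. expectation (\<Delta> k)) / (a ^ ?m) ^ p \<le> 2 ^ ?m * (\<gamma> * (a ^ ?m * a ^ ?m) ^ Suc p) / (a ^ ?m) ^ p"
        using a by (intro divide_right_mono) auto
      also have "\<dots> \<le> \<gamma> * (1 / 2) ^ ?m"
        using p by (intro chaining_rate a \<gamma>0) simp
      finally show ?thesis .
    qed
    finally show ?thesis by simp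
  qed
  have "summable (\<lambda>n. a ^ n + \<gamma> * (1 / 2) ^ n)"
    using a by (intro summable_add summable_mult summable_geometric) auto
  then have sum: "summable (\<lambda>n. a ^ Suc n + \<gamma> * (1 / 2) ^ Suc n)" by (subst summable_Suc_iff)
  have le: "expectation (A n) \<le> expectation (A 0) + (\<Sum>k<n. a ^ Suc k + \<gamma> * (1 / 2) ^ Suc k)" for n
  proof (induction n)
    case (Suc n)
    then show ?case using step[of n] by simp
  qed simp
  have "expectation (A n) \<le> expectation (A 0) + (\<Sum>k. a ^ Suc k + \<gamma> * (1 / 2) ^ Suc k)" for n
  proof -
    have "(\<Sum>k<n. a ^ Suc k + \<gamma> * (1 / 2) ^ Suc k) \<le> (\<Sum>k. a ^ Suc k + \<gamma> * (1 / 2) ^ Suc k)"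
      using sum a \<gamma>0 by (intro sum_le_suminf) auto
    then show ?thesis using le[of n] by linarith
  qed
  then show ?thesis unfolding A_def by (rule that)
qed

text \<open>The grids are nested, so the grid maxima increase at every \<open>\<omega>\<close>, and
  chaining bounds their expectations. Monotone convergence then yields the integrability of the
  supremum together with the limit.\<close>

lemma expected_sup_limit:
  assumes X: "centered_gaussian_process M {0..T} C X" and T: "0 < T" and h: "0 < h"
    and incr: "\<And>s t. s \<in> {0..T} \<Longrightarrow> t \<in> {0..T} \<Longrightarrow> increment_var C s t \<le> c * \<bar>s - t\<bar> powr (2 * h)"
    and cont: "continuous_paths_ae M {0..T} X"
  shows "integrable_sup M {0..T} X"
    and "(\<lambda>n. LINT \<omega>|M. Max ((\<lambda>t. X t \<omega>) ` dyadic_grid T n)) \<longlonglongrightarrow> expected_sup M {0..T} X"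
proof -
  define A where "A n \<omega> = Max ((\<lambda>t. X t \<omega>) ` dyadic_grid T n)" for n \<omega>
  obtain b where b': "\<And>n. (LINT \<omega>|M. Max ((\<lambda>t. X t \<omega>) ` dyadic_grid T n)) \<le> b"
    by (rule expectation_Max_dyadic_grid_bounded[OF X T h incr]) (assumption | rule that)+
  have b: "(LINT \<omega>|M. A n \<omega>) \<le> b" for n unfolding A_def by (rule b')
  have gI: "t \<in> {0..T}" if "t \<in> dyadic_grid T n" for t n
    using that dyadic_grid_subset[of T n] T by auto
  have iA: "integrable M (A n)" for n
    unfolding A_def using centered_gaussian_process_integrable[OF X gI]
    by (intro integrable_Max finite_dyadic_grid dyadic_grid_nonempty)
  then have mA [measurable]: "A n \<in> borel_measurable M" for n by auto
  have monoA: "mono (\<lambda>n. A n \<omega>)" for \<omega>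
    unfolding A_def mono_iff_le_Suc
    by (intro allI Max_mono image_mono dyadic_grid_Suc finite_imageI finite_dyadic_grid) (simp add: dyadic_grid_nonempty)
  have inc: "incseq (\<lambda>n. LINT \<omega>|M. A n \<omega>)"
    using iA monoA by (intro incseq_SucI integral_mono) (auto intro: incseq_SucD[OF monoA])
  obtain L where L: "(\<lambda>n. LINT \<omega>|M. A n \<omega>) \<longlonglongrightarrow> L"
    by (rule incseq_convergent[OF inc, of b]) (use b in auto)
  have lim: "AE \<omega> in M. (\<lambda>n. A n \<omega>) \<longlonglongrightarrow> path_sup {0..T} X \<omega>"
    using cont unfolding continuous_paths_ae_def A_def path_sup_def
    by eventually_elim (rule Max_dyadic_grid_tendsto_SUP[OF T])
  \<comment> \<open>A Borel measurable version of the supremum. The path supremum agrees with it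
    almost surely, which makes it measurable for the completion.\<close>
  define u where "u \<omega> = lim (\<lambda>n. A n \<omega>)" for \<omega>
  have mu [measurable]: "u \<in> borel_measurable M" unfolding u_def by (intro borel_measurable_lim_metric) auto
  have ae: "AE \<omega> in completion M. u \<omega> = path_sup {0..T} X \<omega>"
    using lim by (intro AE_completion) (auto simp: u_def limI)
  have meas: "path_sup {0..T} X \<in> borel_measurable (completion M)"
  proof (rule measurableI)
    fix B :: "real set" assume B: "B \<in> sets borel"
    show "path_sup {0..T} X -` B \<inter> space (completion M) \<in> sets (completion M)"
    proof (rule completion.in_sets_AE)
      show "u -` B \<inter> space M \<in> sets (completion M)" using B by (intro sets_completionI_sets measurable_sets[OF mu])
      show "AE \<omega> in completion M. (\<omega> \<in> u -` B \<inter> space M) = (\<omega> \<in> path_sup {0..T} X -` B \<inter> space (completion M))"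
        using ae by eventually_elim auto
    qed auto
  qed simp
  have iA': "integrable (completion M) (A n)" for n using iA by (simp add: integrable_completion)
  have L': "(\<lambda>n. LINT \<omega>|completion M. A n \<omega>) \<longlonglongrightarrow> L" using L by (simp add: integral_completion)
  have "integrable (completion M) (path_sup {0..T} X)"
    by (rule integrable_monotone_convergence[OF iA' AE_I2[OF monoA] AE_completion[OF lim] L' meas])
  moreover have "(LINT \<omega>|completion M. path_sup {0..T} X \<omega>) = L"
    by (rule integral_monotone_convergence[OF iA' AE_I2[OF monoA] AE_completion[OF lim] L' meas])
  ultimately show "integrable_sup M {0..T} X"
    "(\<lambda>n. LINT \<omega>|M. Max ((\<lambda>t. X t \<omega>) ` dyadic_grid T n)) \<longlonglongrightarrow> expected_sup M {0..T} X"
    using L by (auto simp: integrable_sup_def expected_sup_def A_def)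
qed

section \<open>Scaling, and the comparison of path suprema\<close>

lemma centered_gaussian_process_scale:
  assumes "centered_gaussian_process M I C X"
  shows "centered_gaussian_process M I (\<lambda>s t. a\<^sup>2 * C s t) (\<lambda>t \<omega>. a * X t \<omega>)"
proof -
  have "gaussian_rv M (\<lambda>\<omega>. \<Sum>t\<in>J. c t * (a * X t \<omega>))" if "finite J" "J \<subseteq> I" for J c
    using centered_gaussian_process_combination(1)[OF assms that, of "\<lambda>t. c t * a"] by (simp add: mult.assoc)
  moreover have "(LINT \<omega>|M. a * X s \<omega> * (a * X t \<omega>)) = a\<^sup>2 * C s t" if "s \<in> I" "t \<in> I" for s t
  proof -
    have "a * x * (a * y) = a\<^sup>2 * (x * y)" for x y by (simp add: power2_eq_square)
    then show ?thesis
      using centered_gaussian_process_cov[OF assms that] by (simp only: integral_mult_right_zero)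
  qed
  ultimately show ?thesis
    unfolding centered_gaussian_process_def gaussian_process_def covariance_def
    using centered_gaussian_process_prob[OF assms] centered_gaussian_process_measurable[OF assms]
      centered_gaussian_process_mean[OF assms]
    by auto
qed

lemma continuous_paths_ae_scale:
  "continuous_paths_ae M I X \<Longrightarrow> continuous_paths_ae M I (\<lambda>t \<omega>. a * X t \<omega>)"
  unfolding continuous_paths_ae_def by (elim eventually_mono) (intro continuous_intros)

text \<open>The power bound is required of the dominating process and passes to the other one
  through \<open>incr\<close>. It feeds the chaining; the comparison holds on each grid and survives
  the limit.\<close>

theorem sudakov_fernique_path_sup:
  assumes X: "centered_gaussian_process M {0..T} C X" "continuous_paths_ae M {0..T} X"
    and Y: "centered_gaussian_process N {0..T} D Y" "continuous_paths_ae N {0..T} Y"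
    and "0 < T" "0 < h"
    and incr: "\<And>s t. s \<in> {0..T} \<Longrightarrow> t \<in> {0..T} \<Longrightarrow> increment_var C s t \<le> increment_var D s t"
    and D: "\<And>s t. s \<in> {0..T} \<Longrightarrow> t \<in> {0..T} \<Longrightarrow> increment_var D s t \<le> c * \<bar>s - t\<bar> powr (2 * h)"
  shows "integrable_sup M {0..T} X" "integrable_sup N {0..T} Y"
    "expected_sup M {0..T} X \<le> expected_sup N {0..T} Y"
proof -
  have C: "increment_var C s t \<le> c * \<bar>s - t\<bar> powr (2 * h)" if "s \<in> {0..T}" "t \<in> {0..T}" for s t
    using incr[OF that] D[OF that] by linarith
  note limX = expected_sup_limit[OF X(1) \<open>0 < T\<close> \<open>0 < h\<close> _ X(2), of c]
    and limY = expected_sup_limit[OF Y(1) \<open>0 < T\<close> \<open>0 < h\<close> _ Y(2), of c]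
  show "integrable_sup M {0..T} X" using C by (rule limX)
  show "integrable_sup N {0..T} Y" using D by (rule limY)
  have "(LINT \<omega>|M. Max ((\<lambda>t. X t \<omega>) ` dyadic_grid T n)) \<le> (LINT \<omega>|N. Max ((\<lambda>t. Y t \<omega>) ` dyadic_grid T n))" for n
    using dyadic_grid_subset[of T n] \<open>0 < T\<close>
    by (intro sudakov_fernique_finite[OF X(1) Y(1)] finite_dyadic_grid dyadic_grid_nonempty incr) auto
  then show "expected_sup M {0..T} X \<le> expected_sup N {0..T} Y"
    using limX(2)[OF C] limY(2)[OF D] by (intro LIMSEQ_le) auto
qed

theorem theorem2p3:
  fixes H K T :: real
    and M :: "'a measure" and W :: "real \<Rightarrow> 'a \<Rightarrow> real"
    and N :: "'b measure" and B Y1 Y2 :: "real \<Rightarrow> 'b \<Rightarrow> real"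
  assumes "0 < H" and "H < 1" and "0 < K" and "K \<le> 1" and "0 < T"
    and "bifractional_brownian_motion M {0..T} H K W"
    and "continuous_paths_ae M {0..T} W"
    and "fractional_brownian_motion N {0..T} (H * K) B"
    and "continuous_paths_ae N {0..T} B"
    and "Y1 = (\<lambda>t \<omega>. 2 powr ((1 - K) / 2) * B t \<omega>)"
    and "Y2 = (\<lambda>t \<omega>. 2 powr (- K / 2) * B t \<omega>)"
  shows "integrable_sup M {0..T} W \<and> integrable_sup N {0..T} Y1 \<and> integrable_sup N {0..T} Y2
    \<and> expected_sup M {0..T} W \<le> expected_sup N {0..T} Y1
    \<and> expected_sup M {0..T} W \<ge> expected_sup N {0..T} Y2"
proof -
  have W: "centered_gaussian_process M {0..T} (bifractional_cov H K) W"
    using assms(6) by (simp add: bifractional_brownian_motion_def)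
  have B: "centered_gaussian_process N {0..T} (fractional_cov (H * K)) B"
    using assms(8) by (simp add: fractional_brownian_motion_def)
  have h: "0 < H * K" using assms by simp
  note Y1 = centered_gaussian_process_scale[OF B, of "2 powr ((1 - K) / 2)"]
    continuous_paths_ae_scale[OF assms(9), of "2 powr ((1 - K) / 2)"]
  note Y2 = centered_gaussian_process_scale[OF B, of "2 powr (- K / 2)"]
    continuous_paths_ae_scale[OF assms(9), of "2 powr (- K / 2)"]
  \<comment> \<open>The prefactors of \<open>Y1\<close> and \<open>Y2\<close> are square roots of
    the increment factors.\<close>
  have sq: "(2 powr (x / 2))\<^sup>2 = (2 :: real) powr x" for x by (simp add: power2_eq_square flip: powr_add)
  have inc: "increment_var (\<lambda>s t. a * fractional_cov (H * K) s t) s t = a * \<bar>s - t\<bar> powr (2 * (H * K))"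
    if "s \<in> {0..T}" "t \<in> {0..T}" for a s t
    using increment_var_fractional[OF h, of s t] that
    by (simp add: increment_var_def flip: distrib_left right_diff_distrib)
  have le: "increment_var (bifractional_cov H K) s t \<le> 2 powr (1 - K) * \<bar>s - t\<bar> powr (2 * (H * K))"
    if "s \<in> {0..T}" "t \<in> {0..T}" for s t
    using increment_var_bifractional_le[of H K s t] assms that by (simp add: mult.assoc)
  have ge: "2 powr (- K) * \<bar>s - t\<bar> powr (2 * (H * K)) \<le> increment_var (bifractional_cov H K) s t"
    if "s \<in> {0..T}" "t \<in> {0..T}" for s t
    using increment_var_bifractional_ge[of H K s t] assms that by (simp add: mult.assoc)
  have upper: "integrable_sup M {0..T} W" "integrable_sup N {0..T} Y1"
    "expected_sup M {0..T} W \<le> expected_sup N {0..T} Y1"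
    unfolding assms(10)
    by (rule sudakov_fernique_path_sup[OF W assms(7) Y1 assms(5) h, where c = "2 powr (1 - K)"];
        simp add: inc le sq)+
  \<comment> \<open>The roles are exchanged: \<open>W\<close> now dominates, and its chaining bound
    is the upper estimate of its increments, hence again \<open>c = 2 powr (1 - K)\<close>.\<close>
  have lower: "integrable_sup N {0..T} Y2" "expected_sup N {0..T} Y2 \<le> expected_sup M {0..T} W"
    unfolding assms(11)
    by (rule sudakov_fernique_path_sup[OF Y2 W assms(7) assms(5) h, where c = "2 powr (1 - K)"];
        use sq[of "- K"] in \<open>simp add: inc le ge\<close>)+
  show ?thesis using upper lower by simp
qed

end
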